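(* For positive integers $k\le n$, the Hilbert series of $S_{n,k}$ is $$\mathrm{Hilb}(S_{n,k};q)=\mathrm{rev}_q\big([k]!_q\cdot\mathrm{Stir}_q(n,k)\big).$$
   Context: $S_{n,k}=\mathbb F[x_1,\dots,x_n]/J_{n,k}$ for an arbitrary field $\mathbb F$, where $J_{n,k}$ is the homogeneous ideal generated by $h_k(x_1),h_k(x_1,x_2),\dots,h_k(x_1,\dots,x_n)$ (complete homogeneous symmetric polynomials) and $e_n,e_{n-1},\dots,e_{n-k+1}$ (elementary symmetric polynomials in $x_1,\dots,x_n$). $\mathrm{Hilb}(V;q)=\sum_d\dim(V_d)q^d$ for a graded vector space. $[k]!_q=\prod_{j=1}^k(1+q+\cdots+q^{j-1})$; $\mathrm{Stir}_q(0,k)=\delta_{0,k}$ and $\mathrm{Stir}_q(n,k)=\mathrm{Stir}_q(n-1,k-1)+[k]_q\mathrm{Stir}_q(n-1,k)$; $\mathrm{rev}_q(f)=q^{\deg f}f(q^{-1})$. *)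

theory Defs
  imports "HOL-Library.Poly_Mapping" "HOL-Computational_Algebra.Polynomial"
begin

text \<open>Multivariate polynomials over a field 'a in variables indexed by nat:
  monomials are exponent vectors (finitely supported maps nat to nat).\<close>

type_synonym 'a mpol = "(nat \<Rightarrow>\<^sub>0 nat) \<Rightarrow>\<^sub>0 'a"

definition mscale :: "'a::field \<Rightarrow> 'a mpol \<Rightarrow> 'a mpol" where
  "mscale c p = Poly_Mapping.single 0 c * p"

lemma mpol_vector_space: "vector_space (mscale :: 'a::field \<Rightarrow> 'a mpol \<Rightarrow> 'a mpol)"
proof unfold_locales
  fix a b :: 'a and x y :: "'a mpol"
  show "mscale a (x + y) = mscale a x + mscale a y"
    by (simp add: mscale_def distrib_left)
  show "mscale (a + b) x = mscale a x + mscale b x"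
    by (simp add: mscale_def distrib_right single_add)
  show "mscale a (mscale b x) = mscale (a * b) x"
    by (simp add: mscale_def mult.assoc[symmetric] mult_single)
  show "mscale 1 x = x"
    by (simp add: mscale_def)
qed

definition var :: "nat \<Rightarrow> 'a::field mpol" where
  "var i = Poly_Mapping.single (Poly_Mapping.single i 1) 1"

definition mdeg :: "(nat \<Rightarrow>\<^sub>0 nat) \<Rightarrow> nat" where
  "mdeg m = (\<Sum>i\<in>Poly_Mapping.keys m. Poly_Mapping.lookup m i)"

definition polyring :: "nat \<Rightarrow> 'a::field mpol set" where
  "polyring n = {p. \<forall>m\<in>Poly_Mapping.keys p. Poly_Mapping.keys m \<subseteq> {1..n}}"

definition homog :: "nat \<Rightarrow> nat \<Rightarrow> 'a::field mpol set" where
  "homog n d = {p \<in> polyring n. \<forall>m\<in>Poly_Mapping.keys p. mdeg m = d}"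

definition hsym :: "nat \<Rightarrow> nat \<Rightarrow> 'a::field mpol" where
  "hsym k j = (\<Sum>m\<in>{m. Poly_Mapping.keys m \<subseteq> {1..j} \<and> mdeg m = k}. Poly_Mapping.single m 1)"

definition esym :: "nat \<Rightarrow> nat \<Rightarrow> 'a::field mpol" where
  "esym i n = (\<Sum>S\<in>{S. S \<subseteq> {1..n} \<and> card S = i}. \<Prod>j\<in>S. var j)"

definition gen_ideal :: "nat \<Rightarrow> 'a::field mpol set \<Rightarrow> 'a mpol set" where
  "gen_ideal n G = {p. \<exists>c. (\<forall>g\<in>G. c g \<in> polyring n) \<and> p = (\<Sum>g\<in>G. c g * g)}"

definition Jgens :: "nat \<Rightarrow> nat \<Rightarrow> 'a::field mpol set" where
  "Jgens n k = {hsym k j | j. j \<in> {1..n}} \<union> {esym i n | i. i \<in> {n - k + 1..n}}"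

definition Jideal :: "nat \<Rightarrow> nat \<Rightarrow> 'a::field mpol set" where
  "Jideal n k = gen_ideal n (Jgens n k)"

text \<open>dim (S_{n,k})_d = dim (R_d / (J \<inter> R_d)) = dim R_d - dim (J \<inter> R_d), as J is homogeneous.\<close>
definition hilbS :: "'a::field itself \<Rightarrow> nat \<Rightarrow> nat \<Rightarrow> nat \<Rightarrow> nat" where
  "hilbS _ n k d =
     vector_space.dim (mscale :: 'a \<Rightarrow> 'a mpol \<Rightarrow> 'a mpol) (homog n d)
     - vector_space.dim (mscale :: 'a \<Rightarrow> 'a mpol \<Rightarrow> 'a mpol) (Jideal n k \<inter> homog n d)"

definition qint :: "nat \<Rightarrow> nat poly" where
  "qint k = (\<Sum>j<k. monom 1 j)"

definition qfact :: "nat \<Rightarrow> nat poly" where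
  "qfact k = (\<Prod>j\<in>{1..k}. qint j)"

fun stirq :: "nat \<Rightarrow> nat \<Rightarrow> nat poly" where
  "stirq 0 k = (if k = 0 then 1 else 0)"
| "stirq (Suc n) 0 = 0"
| "stirq (Suc n) (Suc k) = stirq n k + qint (Suc k) * stirq n (Suc k)"

definition revq :: "nat poly \<Rightarrow> nat poly" where
  "revq f = (\<Sum>i\<le>degree f. monom (coeff f i) (degree f - i))"

end

theory Submission
  imports
    Defs
    "HOL-Computational_Algebra.Formal_Power_Series"
    "HOL-Computational_Algebra.Fraction_Field"
begin

text \<open>Peeling off the first variable, the ideal generated by the \<open>h\<^sub>k\<close> of the initial segments of the
  variables and by the top \<open>s\<close> elementary symmetric polynomials yields a recursive set of monomials
  spanning the quotient. These monomials are independent as functions on a finite set of points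
  \<open>Z\<close>: the words over an alphabet of \<open>k\<close> letters, in which every letter that is used is replaced by
  a fresh one, that contain \<open>s\<close> prescribed letters. Every generator is the leading form of a
  polynomial vanishing on \<open>Z\<close>, so the monomials are also independent modulo the ideal. Such points
  exist over an infinite field, and the general case follows by extending the scalars to the
  rational functions. Finally, the generating function of the degrees satisfies the recursion
  of the reversed polynomials \<open>[k]!\<^sub>q Stir\<^sub>q(n,k)\<close>.\<close>

text \<open>The parameter s has to be separate from k, although J_(n,k) is the case s = k. Filter by
  powers of the first variable x, with N variables remaining. In the layer x^c modulo x^(c+1) each
  generator e_r acts as e_r of the remaining variables; since their number has dropped by one, only
  s - 1 of the top degrees survive. From c = s on, x^s e_(N+1-s) of the remaining variables lies in
  the ideal and restores the lost one. The points branch in the same way: s choices of the first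
  letter leave s - 1 prescribed letters, the other k - s choices leave s. Replacing used letters by
  fresh ones makes the first j values distinct elements of a set of k + j - 1 letters. Dividing the
  generating products of the two sets leaves a polynomial of degree k - 1, whose coefficient at t^k
  is zero: this is the deformed h_k. Likewise, covering s letters leaves degree N - s for the
  elementary polynomials in N variables. In the final count the monomials recurse with k fixed and s
  falling, the q-Stirling numbers with k falling. A Pascal-type identity between (k,s), (k,s+1) and
  (k-1,s) connects the two.\<close>

abbreviation keys :: "('a \<Rightarrow>\<^sub>0 'b::zero) \<Rightarrow> 'a set" where
  "keys \<equiv> Poly_Mapping.keys"

abbreviation lookup :: "('a \<Rightarrow>\<^sub>0 'b::zero) \<Rightarrow> 'a \<Rightarrow> 'b" where
  "lookup \<equiv> Poly_Mapping.lookup"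

abbreviation single :: "'a \<Rightarrow> 'b \<Rightarrow> ('a \<Rightarrow>\<^sub>0 'b::zero)" where
  "single \<equiv> Poly_Mapping.single"

section \<open>Finitely supported maps: induction and total degree\<close>

lemma poly_mapping_sum_singles: "p = (\<Sum>m\<in>keys p. single m (lookup p m))"
  by (rule poly_mapping_eqI) (auto simp: lookup_sum lookup_single when_def in_keys_iff)

lemma poly_mapping_keys_induct:
  fixes p :: "'a \<Rightarrow>\<^sub>0 'b::comm_monoid_add"
  assumes "\<And>m c. m \<in> keys p \<Longrightarrow> P (single m c)" and "P 0"
    and "\<And>p q. P p \<Longrightarrow> P q \<Longrightarrow> P (p + q)"
  shows "P p"
proof -
  have "P (\<Sum>m\<in>M. single m (lookup p m))" if "finite M" "M \<subseteq> keys p" for M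
    using that by (induction rule: finite_induct) (auto intro: assms)
  from this[of "keys p"] show ?thesis
    using poly_mapping_sum_singles[of p] by simp
qed

lemma poly_mapping_single_induct [case_names single add]:
  fixes p :: "'a \<Rightarrow>\<^sub>0 'b::comm_monoid_add"
  assumes "\<And>m c. P (single m c)" and "\<And>p q. P p \<Longrightarrow> P q \<Longrightarrow> P (p + q)"
  shows "P p"
proof (rule poly_mapping_keys_induct[of p P])
  show "P 0"
    using assms(1)[of undefined 0] by simp
qed (use assms in auto)

lemma keys_add_eq [simp]: "keys (m + m' :: 'a \<Rightarrow>\<^sub>0 nat) = keys m \<union> keys m'"
  by (auto simp: in_keys_iff lookup_add)

lemma mdeg_superset:
  assumes "finite A" "keys m \<subseteq> A"
  shows "mdeg m = (\<Sum>i\<in>A. lookup m i)"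
  unfolding mdeg_def using assms by (intro sum.mono_neutral_left) (auto simp: in_keys_iff)

lemma mdeg_zero [simp]: "mdeg 0 = 0"
  by (simp add: mdeg_def)

lemma mdeg_add [simp]: "mdeg (m + m') = mdeg m + mdeg m'"
  by (simp add: mdeg_superset[of "keys m \<union> keys m'"] lookup_add sum.distrib)

lemma mdeg_single [simp]: "mdeg (single i e) = e"
  by (simp add: mdeg_superset[of "{i}"])

section \<open>Ring homomorphisms on polynomials\<close>

text \<open>One construction serves both evaluation at a point (\<open>mpeval\<close>) and extension
  of the coefficient field (\<open>map_coeffs\<close>).\<close>

definition mlift :: "('a::comm_ring_1 \<Rightarrow> 'b::comm_ring_1) \<Rightarrow> ('m \<Rightarrow> 'b) \<Rightarrow> ('m \<Rightarrow>\<^sub>0 'a) \<Rightarrow> 'b" where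
  "mlift f g p = (\<Sum>m\<in>keys p. f (lookup p m) * g m)"

locale ring_lift =
  fixes f :: "'a::comm_ring_1 \<Rightarrow> 'b::comm_ring_1" and g :: "'m::comm_monoid_add \<Rightarrow> 'b"
  assumes f_add: "f (a + b) = f a + f b"
    and f_mult: "f (a * b) = f a * f b"
    and g_add: "g (m + m') = g m * g m'"
begin

lemma f_0: "f 0 = 0"
  using f_add[of 0 0] by simp

lemma mlift_superset:
  assumes "finite A" "keys p \<subseteq> A"
  shows "mlift f g p = (\<Sum>m\<in>A. f (lookup p m) * g m)"
  unfolding mlift_def using assms by (intro sum.mono_neutral_left) (auto simp: in_keys_iff f_0)

lemma mlift_single [simp]: "mlift f g (single m c) = f c * g m"
  by (simp add: mlift_superset[of "{m}"] f_0)

lemma mlift_add [simp]: "mlift f g (p + q) = mlift f g p + mlift f g q"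
proof -
  have "keys (p + q) \<subseteq> keys p \<union> keys q"
    by (rule keys_add)
  then show ?thesis
    by (simp add: mlift_superset[of "keys p \<union> keys q"] lookup_add f_add sum.distrib distrib_right)
qed

lemma mlift_0 [simp]: "mlift f g 0 = 0"
  by (simp add: mlift_def)

lemma mlift_sum [simp]: "mlift f g (sum h A) = (\<Sum>a\<in>A. mlift f g (h a))"
  by (induction A rule: infinite_finite_induct) auto

lemma mlift_mult [simp]: "mlift f g (p * q) = mlift f g p * mlift f g q"
proof (induction p rule: poly_mapping_single_induct)
  case (single m c)
  show ?case
    by (induction q rule: poly_mapping_single_induct)
       (simp_all add: mult_single f_mult g_add distrib_left mult.assoc mult.left_commute)
qed (simp add: distrib_right)

end

lemma (in ring_lift) mlift_diff [simp]: "mlift f g (p - q) = mlift f g p - mlift f g q"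
proof -
  have "mlift f g (p - q) + mlift f g q = mlift f g p"
    by (simp flip: mlift_add)
  then show ?thesis
    by (simp add: eq_diff_eq)
qed

definition monom_value :: "(nat \<Rightarrow> 'a::comm_ring_1) \<Rightarrow> (nat \<Rightarrow>\<^sub>0 nat) \<Rightarrow> 'a" where
  "monom_value x m = (\<Prod>i\<in>keys m. x i ^ lookup m i)"

lemma monom_value_superset:
  assumes "finite A" "keys m \<subseteq> A"
  shows "monom_value x m = (\<Prod>i\<in>A. x i ^ lookup m i)"
  unfolding monom_value_def using assms by (intro prod.mono_neutral_left) (auto simp: in_keys_iff)

lemma monom_value_0 [simp]: "monom_value x 0 = 1"
  by (simp add: monom_value_def)

lemma monom_value_single [simp]: "monom_value x (single i e) = x i ^ e"
  by (simp add: monom_value_superset[of "{i}"])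

lemma monom_value_add: "monom_value x (m + m') = monom_value x m * monom_value x m'"
  by (simp add: monom_value_superset[of "keys m \<union> keys m'"] lookup_add power_add prod.distrib)

definition mpeval :: "(nat \<Rightarrow> 'a::field) \<Rightarrow> 'a mpol \<Rightarrow> 'a" where
  "mpeval x = mlift (\<lambda>a. a) (monom_value x)"

interpretation mpeval: ring_lift "\<lambda>a. a" "monom_value (x :: nat \<Rightarrow> 'a::field)"
  rewrites "mlift (\<lambda>a. a) (monom_value x) = mpeval x" for x
  by unfold_locales (auto simp: monom_value_add mpeval_def)

lemma mpeval_const [simp]: "mpeval x (single 0 c) = c"
  by simp

lemma mpeval_var [simp]: "mpeval x (var i) = x i"
  by (simp add: var_def)

definition map_coeffs :: "('a::field \<Rightarrow> 'b::field) \<Rightarrow> 'a mpol \<Rightarrow> 'b mpol" where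
  "map_coeffs f = mlift (\<lambda>a. single 0 (f a)) (\<lambda>m. single m 1)"

lemma lookup_map_coeffs:
  assumes "f 0 = 0"
  shows "lookup (map_coeffs f p) m = f (lookup p m)"
proof -
  have "lookup (map_coeffs f p) m = (\<Sum>m'\<in>keys p. if m' = m then f (lookup p m') else 0)"
    unfolding map_coeffs_def mlift_def lookup_sum
    by (rule sum.cong) (simp_all add: mult_single lookup_single when_def)
  also have "\<dots> = (if m \<in> keys p then f (lookup p m) else 0)"
    by (rule sum.delta) simp
  also have "\<dots> = f (lookup p m)"
    using assms by (cases "m \<in> keys p") (simp_all add: not_in_keys_iff_lookup_eq_zero)
  finally show ?thesis .
qed

section \<open>Gradings and ideals\<close>

text \<open>The variable set is arbitrary because peeling off the first variable leaves an interval
  that no longer starts at 1.\<close>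

definition pvars :: "nat set \<Rightarrow> 'a::field mpol set" where
  "pvars W = {p. \<forall>m\<in>keys p. keys m \<subseteq> W}"

lemma polyring_eq_pvars: "polyring n = pvars {1..n}"
  by (simp add: polyring_def pvars_def)

lemma pvars_0 [simp]: "0 \<in> pvars W"
  by (simp add: pvars_def)

lemma pvars_add [intro]: "p \<in> pvars W \<Longrightarrow> q \<in> pvars W \<Longrightarrow> p + q \<in> pvars W"
  unfolding pvars_def using keys_add[of p q] by blast

lemma pvars_diff [intro]: "p \<in> pvars W \<Longrightarrow> q \<in> pvars W \<Longrightarrow> p - q \<in> pvars W"
  unfolding pvars_def using keys_diff[of p q] by blast

lemma pvars_mult [intro]: "p \<in> pvars W \<Longrightarrow> q \<in> pvars W \<Longrightarrow> p * q \<in> pvars W"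
  unfolding pvars_def using keys_mult[of p q] by (auto dest!: subsetD)

lemma pvars_sum [intro]: "(\<And>a. a \<in> A \<Longrightarrow> f a \<in> pvars W) \<Longrightarrow> sum f A \<in> pvars W"
  by (induction A rule: infinite_finite_induct) auto

lemma pvars_single [intro]: "keys m \<subseteq> W \<Longrightarrow> single m c \<in> pvars W"
  by (auto simp: pvars_def)

lemma pvars_1 [simp]: "1 \<in> pvars W"
  by (auto simp: pvars_def)

lemma pvars_prod [intro]: "(\<And>a. a \<in> A \<Longrightarrow> f a \<in> pvars W) \<Longrightarrow> prod f A \<in> pvars W"
  by (induction A rule: infinite_finite_induct) auto

lemma pvars_var [intro]: "i \<in> W \<Longrightarrow> var i \<in> pvars W"
  by (auto simp: pvars_def var_def)

lemma pvars_power [intro]: "p \<in> pvars W \<Longrightarrow> p ^ e \<in> pvars W"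
  by (induction e) auto

lemma pvars_mono: "W \<subseteq> W' \<Longrightarrow> pvars W \<subseteq> pvars W'"
  by (auto simp: pvars_def)

definition hom_of_deg :: "nat \<Rightarrow> 'a::field mpol set" where
  "hom_of_deg d = {p. \<forall>m\<in>keys p. mdeg m = d}"

lemma homog_eq: "homog n d = pvars {1..n} \<inter> hom_of_deg d"
  by (auto simp: homog_def polyring_eq_pvars hom_of_deg_def)

lemma hom_of_deg_mult: "p \<in> hom_of_deg d \<Longrightarrow> q \<in> hom_of_deg e \<Longrightarrow> p * q \<in> hom_of_deg (d + e)"
  unfolding hom_of_deg_def using keys_mult[of p q] by (auto dest!: subsetD)

lemma hom_of_deg_0 [simp]: "0 \<in> hom_of_deg d"
  by (simp add: hom_of_deg_def)

lemma hom_of_deg_add: "p \<in> hom_of_deg d \<Longrightarrow> q \<in> hom_of_deg d \<Longrightarrow> p + q \<in> hom_of_deg d"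
  unfolding hom_of_deg_def using keys_add[of p q] by blast

lemma hom_of_deg_diff: "p \<in> hom_of_deg d \<Longrightarrow> q \<in> hom_of_deg d \<Longrightarrow> p - q \<in> hom_of_deg d"
  unfolding hom_of_deg_def using keys_diff[of p q] by blast

lemma hom_of_deg_sum: "(\<And>a. a \<in> A \<Longrightarrow> f a \<in> hom_of_deg d) \<Longrightarrow> sum f A \<in> hom_of_deg d"
  by (induction A rule: infinite_finite_induct) (auto intro: hom_of_deg_add)

lemma hom_of_deg_single: "mdeg m = d \<Longrightarrow> single m c \<in> hom_of_deg d"
  by (auto simp: hom_of_deg_def)

text \<open>For \<open>g\<close> homogeneous of degree \<open>d\<close>,
  \<open>h - g \<in> lower_deg W d\<close> encodes that \<open>g\<close> is the degree
  \<open>d\<close> leading form of \<open>h\<close>. This wording stays meaningful when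
  \<open>g\<close> is zero.\<close>

definition lower_deg :: "nat set \<Rightarrow> nat \<Rightarrow> 'a::field mpol set" where
  "lower_deg W d = {p \<in> pvars W. \<forall>m\<in>keys p. mdeg m < d}"

lemma lower_deg_0 [simp]: "0 \<in> lower_deg W d"
  by (simp add: lower_deg_def)

lemma lower_deg_add: "p \<in> lower_deg W d \<Longrightarrow> q \<in> lower_deg W d \<Longrightarrow> p + q \<in> lower_deg W d"
  unfolding lower_deg_def using keys_add[of p q] pvars_add[of p W q] by blast

lemma lower_deg_diff: "p \<in> lower_deg W d \<Longrightarrow> q \<in> lower_deg W d \<Longrightarrow> p - q \<in> lower_deg W d"
  unfolding lower_deg_def using keys_diff[of p q] pvars_diff[of p W q] by blast

lemma lower_deg_sum: "(\<And>a. a \<in> A \<Longrightarrow> f a \<in> lower_deg W d) \<Longrightarrow> sum f A \<in> lower_deg W d"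
  by (induction A rule: infinite_finite_induct) (auto intro: lower_deg_add)

lemma lower_deg_mult:
  assumes "p \<in> pvars W" "p \<in> hom_of_deg d" "q \<in> lower_deg W e"
  shows "p * q \<in> lower_deg W (d + e)"
  using assms keys_mult[of p q] pvars_mult[of p W q]
  by (auto simp: lower_deg_def hom_of_deg_def dest!: subsetD)

definition hcomp :: "nat \<Rightarrow> 'a::field mpol \<Rightarrow> 'a mpol" where
  "hcomp d p = (\<Sum>m\<in>{m \<in> keys p. mdeg m = d}. single m (lookup p m))"

lemma lookup_hcomp: "lookup (hcomp d p) m = (if mdeg m = d then lookup p m else 0)"
  by (auto simp: hcomp_def lookup_sum lookup_single when_def in_keys_iff)

lemma keys_hcomp: "keys (hcomp d p) = {m \<in> keys p. mdeg m = d}"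
  by (auto simp: in_keys_iff lookup_hcomp split: if_splits)

lemma hcomp_hom [simp]: "hcomp d p \<in> hom_of_deg d"
  by (auto simp: hom_of_deg_def keys_hcomp)

lemma hcomp_pvars [intro]: "p \<in> pvars W \<Longrightarrow> hcomp d p \<in> pvars W"
  by (auto simp: pvars_def keys_hcomp)

lemma hcomp_0 [simp]: "hcomp d 0 = 0"
  by (simp add: hcomp_def)

lemma hcomp_add: "hcomp d (p + q) = hcomp d p + hcomp d q"
  by (rule poly_mapping_eqI) (simp add: lookup_hcomp lookup_add)

lemma hcomp_of_hom: "p \<in> hom_of_deg e \<Longrightarrow> hcomp d p = (if d = e then p else 0)"
  by (rule poly_mapping_eqI) (auto simp: lookup_hcomp hom_of_deg_def in_keys_iff)

lemma hcomp_mult_hom: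
  assumes "g \<in> hom_of_deg e"
  shows "hcomp d (p * g) = (if e \<le> d then hcomp (d - e) p * g else 0)"
proof (induction p rule: poly_mapping_single_induct)
  case (single m c)
  have "single m c * g \<in> hom_of_deg (mdeg m + e)"
    by (intro hom_of_deg_mult assms hom_of_deg_single) auto
  moreover have "single m c \<in> hom_of_deg (mdeg m)"
    by (intro hom_of_deg_single) auto
  ultimately show ?case
    by (auto simp: hcomp_of_hom)
qed (simp add: hcomp_add distrib_right)

text \<open>The inductive form allows proofs that add one multiple of a generator at a time. For
  finite \<open>G\<close> it agrees with \<open>gen_ideal\<close>, see
  \<open>gen_ideal_eq_idl\<close>.\<close>

inductive_set idl :: "nat set \<Rightarrow> 'a::field mpol set \<Rightarrow> 'a mpol set"
  for W G where
  zero: "0 \<in> idl W G"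
| step: "p \<in> idl W G \<Longrightarrow> c \<in> pvars W \<Longrightarrow> g \<in> G \<Longrightarrow> p + c * g \<in> idl W G"

lemma idl_generator_mult: "c \<in> pvars W \<Longrightarrow> g \<in> G \<Longrightarrow> c * g \<in> idl W G"
  using idl.step[OF idl.zero] by fastforce

lemma idl_add:
  assumes "p \<in> idl W G" "q \<in> idl W G"
  shows "p + q \<in> idl W G"
  using assms(2,1) by induction (auto simp flip: add.assoc intro: idl.step)

lemma idl_mult: "p \<in> idl W G \<Longrightarrow> c \<in> pvars W \<Longrightarrow> c * p \<in> idl W G"
  by (induction p rule: idl.induct)
     (auto simp: distrib_left intro!: idl.zero idl_add idl_generator_mult simp flip: mult.assoc)

lemma idl_uminus: "p \<in> idl W G \<Longrightarrow> - p \<in> idl W G"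
  using idl_mult[of p W G "0 - 1"] pvars_diff[OF pvars_0 pvars_1, of W] by simp

lemma idl_diff: "p \<in> idl W G \<Longrightarrow> q \<in> idl W G \<Longrightarrow> p - q \<in> idl W G"
  using idl_add[of p W G "- q"] idl_uminus[of q W G] by simp

lemma gen_ideal_eq_idl:
  assumes "finite G"
  shows "gen_ideal n G = idl {1..n} G"
proof (intro equalityI subsetI)
  fix p assume "p \<in> gen_ideal n G"
  then obtain c where c: "\<forall>g\<in>G. c g \<in> pvars {1..n}" "p = (\<Sum>g\<in>G. c g * g)"
    by (auto simp: gen_ideal_def polyring_eq_pvars)
  have "(\<Sum>g\<in>H. c g * g) \<in> idl {1..n} G" if "H \<subseteq> G" for H
    using finite_subset[OF that assms] that
    by induction (use c in \<open>auto intro!: idl.zero idl_add idl_generator_mult\<close>)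
  then show "p \<in> idl {1..n} G"
    using c by blast
next
  fix p assume "p \<in> idl {1..n} G"
  then show "p \<in> gen_ideal n G"
  proof induction
    case zero
    show ?case
      by (auto simp: gen_ideal_def polyring_eq_pvars intro!: exI[of _ "\<lambda>_. 0"])
  next
    case (step p c g)
    then obtain b where b: "\<forall>g\<in>G. b g \<in> pvars {1..n}" "p = (\<Sum>g\<in>G. b g * g)"
      by (auto simp: gen_ideal_def polyring_eq_pvars)
    have "(\<Sum>h\<in>G. (b(g := b g + c)) h * h) = (\<Sum>h\<in>G. b h * h + (if h = g then c * g else 0))"
      by (intro sum.cong) (auto simp: distrib_right)
    also have "\<dots> = p + c * g"
      using assms step.hyps by (simp add: sum.distrib b)
    finally show ?case
      using b step.hyps by (auto simp: gen_ideal_def polyring_eq_pvars intro!: exI[of _ "b(g := b g + c)"] pvars_add)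
  qed
qed

section \<open>Symmetric polynomials in a set of variables\<close>

lemma var_power: "var v ^ c = single (single v c) 1"
  by (induction c) (simp_all add: var_def mult_single single_add[symmetric])

lemma finite_monomials:
  assumes "finite W"
  shows "finite {m. keys m \<subseteq> W \<and> mdeg m = k}"
proof -
  let ?F = "{f :: nat \<Rightarrow> nat. \<forall>x. (x \<in> W \<longrightarrow> f x \<in> {..k}) \<and> (x \<notin> W \<longrightarrow> f x = 0)}"
  have le: "lookup m x \<le> mdeg m" for m x
  proof (cases "x \<in> keys m")
    case True
    then show ?thesis
      unfolding mdeg_def by (intro member_le_sum) auto
  qed (simp add: in_keys_iff)
  have "lookup ` {m. keys m \<subseteq> W \<and> mdeg m = k} \<subseteq> ?F"
    using le by (auto simp: in_keys_iff)
  moreover have "finite ?F"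
    using assms by (intro finite_set_of_finite_funs) auto
  ultimately have "finite (lookup ` {m. keys m \<subseteq> W \<and> mdeg m = k})"
    by (rule finite_subset)
  then show ?thesis
    by (rule finite_imageD) (simp add: inj_on_def lookup_inject)
qed

definition hsym_on :: "nat set \<Rightarrow> nat \<Rightarrow> 'a::field mpol" where
  "hsym_on W k = (\<Sum>m\<in>{m. keys m \<subseteq> W \<and> mdeg m = k}. single m 1)"

definition esym_on :: "nat set \<Rightarrow> nat \<Rightarrow> 'a::field mpol" where
  "esym_on W r = (\<Sum>S\<in>{S. S \<subseteq> W \<and> card S = r}. \<Prod>j\<in>S. var j)"

lemma hsym_on_pvars [intro]: "W \<subseteq> W' \<Longrightarrow> hsym_on W k \<in> pvars W'"
  unfolding hsym_on_def by (intro pvars_sum pvars_single) auto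

lemma esym_on_pvars [intro]: "W \<subseteq> W' \<Longrightarrow> esym_on W k \<in> pvars W'"
  unfolding esym_on_def by (intro pvars_sum pvars_prod pvars_var) auto

lemma hsym_on_hom: "hsym_on W k \<in> hom_of_deg k"
  unfolding hsym_on_def by (intro hom_of_deg_sum hom_of_deg_single) auto

lemma esym_on_hom:
  assumes "finite W"
  shows "esym_on W r \<in> hom_of_deg r"
proof -
  have "(\<Prod>j\<in>S. var j) \<in> hom_of_deg (card S)" if "finite S" for S
    using that
  proof induction
    case (insert x F)
    have "var x \<in> hom_of_deg 1"
      unfolding var_def by (intro hom_of_deg_single) simp
    from hom_of_deg_mult[OF this insert.IH] insert.hyps show ?case
      by simp
  qed (auto simp: hom_of_deg_def)
  then show ?thesis
    unfolding esym_on_def using finite_subset[OF _ assms] by (intro hom_of_deg_sum) auto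
qed

lemma hsym_on_0 [simp]: "hsym_on W 0 = 1"
proof -
  have "{m. keys m \<subseteq> W \<and> mdeg m = 0} = {0}"
  proof (intro equalityI subsetI)
    fix m assume "m \<in> {m. keys m \<subseteq> W \<and> mdeg m = 0}"
    then have "lookup m i = 0" for i
      by (auto simp: mdeg_def in_keys_iff)
    then show "m \<in> {0}"
      by (simp add: poly_mapping_eqI)
  qed auto
  then show ?thesis
    by (simp add: hsym_on_def)
qed

lemma hsym_on_empty: "hsym_on {} (Suc k) = 0"
proof -
  have "{m. keys m \<subseteq> {} \<and> mdeg m = Suc k} = {}"
    by (auto simp: mdeg_def)
  then show ?thesis
    by (simp only: hsym_on_def sum.empty)
qed

text \<open>Monomials are sorted by whether \<open>v\<close> occurs. Dividing by \<open>v\<close>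
  once may leave further factors \<open>v\<close>, hence \<open>insert v W\<close> in the last term,
  in contrast to \<open>esym_on_insert\<close>.\<close>

lemma hsym_on_insert:
  assumes "finite W" "v \<notin> W"
  shows "hsym_on (insert v W) (Suc k) = hsym_on W (Suc k) + var v * hsym_on (insert v W) k"
proof -
  define M where "M W k = {m :: nat \<Rightarrow>\<^sub>0 nat. keys m \<subseteq> W \<and> mdeg m = k}" for W k
  have fin: "finite (M A j)" if "finite A" for A j
    unfolding M_def using that by (rule finite_monomials)
  have split: "M (insert v W) (Suc k) = M W (Suc k) \<union> (+) (single v 1) ` M (insert v W) k"
  proof (intro equalityI subsetI)
    fix m assume m: "m \<in> M (insert v W) (Suc k)"
    show "m \<in> M W (Suc k) \<union> (+) (single v 1) ` M (insert v W) k"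
    proof (cases "v \<in> keys m")
      case True
      then have eq: "m = single v 1 + (m - single v 1)"
        by (intro poly_mapping_eqI) (auto simp: lookup_add lookup_minus lookup_single when_def in_keys_iff)
      have "keys (m - single v 1) \<subseteq> keys m"
        by (auto simp: in_keys_iff lookup_minus)
      moreover have "mdeg m = 1 + mdeg (m - single v 1)"
        by (subst eq) simp
      ultimately have "m - single v 1 \<in> M (insert v W) k"
        using m by (auto simp: M_def)
      then show ?thesis
        using eq by blast
    qed (use m in \<open>auto simp: M_def\<close>)
  qed (auto simp: M_def)
  have "hsym_on (insert v W) (Suc k) = (\<Sum>m\<in>M W (Suc k). single m 1)
      + (\<Sum>m\<in>(+) (single v 1) ` M (insert v W) k. single m (1::'a))"
    unfolding hsym_on_def M_def[symmetric] split
    using assms by (intro sum.union_disjoint finite_imageI fin) (auto simp: M_def)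
  also have "(\<Sum>m\<in>(+) (single v 1) ` M (insert v W) k. single m (1::'a))
      = var v * (\<Sum>m\<in>M (insert v W) k. single m 1)"
    by (subst sum.reindex) (auto simp: inj_on_def sum_distrib_left var_def mult_single)
  finally show ?thesis
    by (simp add: hsym_on_def M_def)
qed

lemma hsym_on_singleton: "hsym_on {v} k = var v ^ k"
  by (induction k) (simp_all add: hsym_on_insert hsym_on_empty)

lemma esym_on_0 [simp]:
  assumes "finite W"
  shows "esym_on W 0 = 1"
proof -
  have "{S. S \<subseteq> W \<and> card S = 0} = {{}}"
    using finite_subset[OF _ assms] by auto
  then show ?thesis
    by (simp only: esym_on_def) simp
qed

lemma esym_on_eq_0:
  assumes "finite W" "card W < r"
  shows "esym_on W r = 0"
proof -
  have "{S. S \<subseteq> W \<and> card S = r} = {}"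
    using assms card_mono[OF assms(1)] by (auto simp: not_le[symmetric])
  then show ?thesis
    by (simp only: esym_on_def sum.empty)
qed

lemma esym_on_insert:
  assumes "finite W" "v \<notin> W"
  shows "esym_on (insert v W) (Suc r) = esym_on W (Suc r) + var v * esym_on W r"
proof -
  define C where "C r = {S. S \<subseteq> W \<and> card S = r}" for r
  have fin: "finite (C j)" for j
    unfolding C_def using assms by simp
  have fS: "finite S" if "S \<in> C j" for S j
    using that assms finite_subset by (auto simp: C_def)
  have split: "{S. S \<subseteq> insert v W \<and> card S = Suc r} = C (Suc r) \<union> insert v ` C r"
  proof (intro equalityI subsetI)
    fix S assume S: "S \<in> {S. S \<subseteq> insert v W \<and> card S = Suc r}"
    show "S \<in> C (Suc r) \<union> insert v ` C r"
    proof (cases "v \<in> S")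
      case True
      then have "S = insert v (S - {v})" "S - {v} \<in> C r"
        using S by (auto simp: C_def)
      then show ?thesis
        by blast
    qed (use S in \<open>auto simp: C_def\<close>)
  next
    fix S assume "S \<in> C (Suc r) \<union> insert v ` C r"
    then show "S \<in> {S. S \<subseteq> insert v W \<and> card S = Suc r}"
      using fS assms by (fastforce simp: C_def card_insert_if)
  qed
  have "esym_on (insert v W) (Suc r) = (\<Sum>S\<in>C (Suc r). \<Prod>j\<in>S. var j)
      + (\<Sum>S\<in>insert v ` C r. \<Prod>j\<in>S. var j :: 'a mpol)"
    unfolding esym_on_def split
    using assms by (intro sum.union_disjoint finite_imageI fin) (auto simp: C_def)
  also have "(\<Sum>S\<in>insert v ` C r. \<Prod>j\<in>S. var j :: 'a mpol) = (\<Sum>S\<in>C r. \<Prod>j\<in>insert v S. var j)"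
    using assms by (subst sum.reindex) (auto simp: C_def inj_on_def insert_ident)
  also have "\<dots> = (\<Sum>S\<in>C r. var v * (\<Prod>j\<in>S. var j))"
  proof (rule sum.cong)
    fix S assume S: "S \<in> C r"
    have "v \<notin> S"
      using S assms(2) unfolding C_def by blast
    with fS[OF S] show "(\<Prod>j\<in>insert v S. var j) = var v * (\<Prod>j\<in>S. var j :: 'a mpol)"
      by (rule prod.insert)
  qed (rule refl)
  also have "\<dots> = var v * (\<Sum>S\<in>C r. \<Prod>j\<in>S. var j)"
    by (rule sum_distrib_left[symmetric])
  finally show ?thesis
    by (simp add: esym_on_def C_def)
qed

section \<open>Standard monomials span the quotient\<close>

text \<open>\<open>s\<close> counts the elementary symmetric generators of top degree. Behind an
  exponent c < s one of them is lost, behind s \<le> c none is; exponents from \<open>k\<close> on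
  are reducible since h_k of a single variable is its k-th power. Without variables, s > 0 puts e_0
  = 1 into the ideal, so nothing remains.\<close>

fun stdexp :: "nat \<Rightarrow> nat \<Rightarrow> nat \<Rightarrow> nat list set" where
  "stdexp k 0 s = (if s = 0 then {[]} else {})"
| "stdexp k (Suc N) s = {c # e | c e. c < s \<and> e \<in> stdexp k N (s - 1)}
     \<union> {c # e | c e. s \<le> c \<and> c < k \<and> e \<in> stdexp k N s}"

fun expmon :: "nat \<Rightarrow> nat list \<Rightarrow> (nat \<Rightarrow>\<^sub>0 nat)" where
  "expmon v [] = 0"
| "expmon v (c # e) = single v c + expmon (Suc v) e"

text \<open>The bound \<open>N < r + s\<close> avoids a truncated N - s: for s > N it admits r = 0,
  so the ideal becomes the unit ideal, in accordance with \<open>stdexp\<close>.\<close>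

definition gens :: "nat \<Rightarrow> nat \<Rightarrow> nat \<Rightarrow> nat \<Rightarrow> 'a::field mpol set" where
  "gens k v N s = {hsym_on {v..<v + j} k | j. 1 \<le> j \<and> j \<le> N}
     \<union> {esym_on {v..<v + N} r | r. r \<le> N \<and> N < r + s}"

lemma gens_pvars: "gens k v N s \<subseteq> pvars {v..<v + N}"
  by (auto simp: gens_def)

lemma hsym_on_in_gens: "1 \<le> j \<Longrightarrow> j \<le> N \<Longrightarrow> hsym_on {v..<v + j} k \<in> gens k v N s"
  by (auto simp: gens_def)

lemma esym_on_in_gens: "r \<le> N \<Longrightarrow> N < r + s \<Longrightarrow> esym_on {v..<v + N} r \<in> gens k v N s"
  by (auto simp: gens_def)

lemma insert_interval: "insert v {Suc v..<Suc (v + N)} = {v..<Suc (v + N)}"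
  by auto

text \<open>Multiply e_(N+1-j)(V) = e_(N+1-j)(V') + x e_(N-j)(V') by x^j: for j < s the left side is
  in the ideal, so membership passes from j to j + 1. It starts with e_(N+1)(V') = 0, as V' has only
  N elements. The case j = s supplies the generator that the layers c \<ge> s regain.\<close>

lemma var_power_esym_in_idl:
  assumes "j \<le> s" "j \<le> Suc N"
  shows "var v ^ j * esym_on {Suc v..<Suc v + N} (Suc N - j)
     \<in> (idl {v..<v + Suc N} (gens k v (Suc N) s) :: 'a::field mpol set)"
  using assms
proof (induction j)
  case 0
  show ?case
    by (simp add: esym_on_eq_0 idl.zero)
next
  case (Suc j)
  let ?V = "{v..<v + Suc N}" and ?V' = "{Suc v..<Suc v + N}"
  let ?J = "idl ?V (gens k v (Suc N) s) :: 'a mpol set"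
  have eq: "esym_on ?V (Suc (N - j)) = esym_on ?V' (Suc (N - j)) + var v * (esym_on ?V' (N - j) :: 'a mpol)"
    using esym_on_insert[of ?V' v "N - j"] by (simp add: insert_interval)
  have "var v ^ j * esym_on ?V (Suc (N - j)) \<in> ?J"
    using Suc.prems by (intro idl_generator_mult esym_on_in_gens pvars_power pvars_var) auto
  then have "var v ^ j * esym_on ?V (Suc (N - j)) - var v ^ j * esym_on ?V' (Suc N - j)
      \<in> ?J"
    by (rule idl_diff) (use Suc.IH Suc.prems in simp)
  also have "var v ^ j * esym_on ?V (Suc (N - j)) - var v ^ j * esym_on ?V' (Suc N - j)
      = var v ^ Suc j * (esym_on ?V' (Suc N - Suc j) :: 'a mpol)"
    unfolding eq using Suc.prems by (simp add: Suc_diff_le algebra_simps)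
  finally show ?case .
qed

text \<open>Relations among the remaining variables hold in the layer x^c up to a multiple of
  x^(c+1). For a generator this follows from the recursions of h_k and e_r, whose second term
  carries a factor x.\<close>

lemma var_power_times_idl:
  assumes "1 \<le> k" "p \<in> idl {Suc v..<Suc v + N} (gens k (Suc v) N (if c < s then s - 1 else s))"
  shows "\<exists>q\<in>pvars {v..<v + Suc N}.
    var v ^ c * p - var v ^ Suc c * q \<in> idl {v..<v + Suc N} (gens k v (Suc N) s)"
  using assms(2)
proof induction
  case zero
  show ?case
    by (intro bexI[of _ 0]) (auto intro: idl.zero)
next
  case (step p a g)
  let ?V = "{v..<v + Suc N}" and ?V' = "{Suc v..<Suc v + N}"
  let ?J = "idl ?V (gens k v (Suc N) s) :: 'a mpol set"
  have a: "a \<in> pvars ?V"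
    using step.hyps pvars_mono[of ?V' ?V] by auto
  have v: "var v \<in> pvars ?V"
    by auto
  consider j where "g = hsym_on {Suc v..<Suc v + j} k" "1 \<le> j" "j \<le> N"
    | r where "g = esym_on ?V' r" "r \<le> N" "N < r + (if c < s then s - 1 else s)"
    using step.hyps(3) unfolding gens_def by blast
  then have "\<exists>q\<in>pvars ?V. var v ^ c * g - var v ^ Suc c * q \<in> ?J"
  proof cases
    fix j assume g: "g = hsym_on {Suc v..<Suc v + j} k" and j: "1 \<le> j" "j \<le> N"
    obtain k' where k': "k = Suc k'"
      using assms by (cases k) auto
    have "hsym_on {v..<v + Suc j} k = g + var v * hsym_on {v..<v + Suc j} k'"
      using hsym_on_insert[of "{Suc v..<Suc v + j}" v k'] by (simp add: insert_interval g k')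
    then have "var v ^ c * g - var v ^ Suc c * (- hsym_on {v..<v + Suc j} k')
        = var v ^ c * hsym_on {v..<v + Suc j} k"
      by (simp add: algebra_simps)
    moreover have "var v ^ c * hsym_on {v..<v + Suc j} k \<in> ?J"
      using j v by (intro idl_generator_mult hsym_on_in_gens pvars_power) auto
    moreover have "- hsym_on {v..<v + Suc j} k' \<in> pvars ?V"
      using pvars_diff[OF pvars_0 hsym_on_pvars[of "{v..<v + Suc j}" ?V k']] j by simp
    ultimately show ?thesis
      by metis
  next
    fix r assume g: "g = esym_on ?V' r" and r: "r \<le> N" "N < r + (if c < s then s - 1 else s)"
    show ?thesis
    proof (cases "Suc N < r + s")
      case True
      then have mem: "var v ^ c * esym_on ?V r \<in> ?J"
        using r v by (intro idl_generator_mult esym_on_in_gens pvars_power) auto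
      show ?thesis
      proof (cases r)
        case 0
        then show ?thesis
          using mem g by (intro bexI[of _ 0]) auto
      next
        case (Suc r')
        have "esym_on ?V r = g + var v * esym_on ?V' r'"
          using esym_on_insert[of ?V' v r'] by (simp add: insert_interval g Suc)
        then have "var v ^ c * g - var v ^ Suc c * (- esym_on ?V' r') = var v ^ c * esym_on ?V r"
          by (simp add: algebra_simps)
        moreover have "- esym_on ?V' r' \<in> pvars ?V"
          using pvars_diff[OF pvars_0 esym_on_pvars[of ?V' ?V r']] by simp
        ultimately show ?thesis
          using mem by metis
      qed
    next
      case False
      \<comment> \<open>The only degree not covered by a generator in all variables; it occurs only
        in the layers c \<ge> s, where x^s e_r is itself in the ideal.\<close>
      then have c: "s \<le> c" and r': "r = Suc N - s" "s \<le> Suc N"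
        using r by (auto split: if_splits)
      have "var v ^ (c - s) * (var v ^ s * g) \<in> ?J"
        unfolding g r' using v r' by (intro idl_mult var_power_esym_in_idl) auto
      moreover have "var v ^ (c - s) * (var v ^ s * g) = var v ^ c * g"
        using c by (simp add: mult.assoc[symmetric] power_add[symmetric])
      ultimately show ?thesis
        by (intro bexI[of _ 0]) auto
    qed
  qed
  then obtain q where q: "q \<in> pvars ?V" "var v ^ c * g - var v ^ Suc c * q \<in> ?J"
    by blast
  from step.IH obtain q' where q': "q' \<in> pvars ?V" "var v ^ c * p - var v ^ Suc c * q' \<in> ?J"
    by blast
  have "(var v ^ c * p - var v ^ Suc c * q') + a * (var v ^ c * g - var v ^ Suc c * q) \<in> ?J"
    by (intro idl_add q' idl_mult q a)
  also have "(var v ^ c * p - var v ^ Suc c * q') + a * (var v ^ c * g - var v ^ Suc c * q)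
      = var v ^ c * (p + a * g) - var v ^ Suc c * (q' + a * q)"
    by (simp add: algebra_simps)
  finally show ?case
    using q q' a by blast
qed

lemma pvars_insert_decomp:
  assumes "p \<in> pvars (insert v W)"
  shows "\<exists>p0\<in>pvars W. \<exists>p1\<in>pvars (insert v W). p = p0 + var v * p1"
proof (rule poly_mapping_keys_induct[of p], goal_cases single zero add)
  case (single m c)
  then have m: "keys m \<subseteq> insert v W"
    using assms by (auto simp: pvars_def)
  show ?case
  proof (cases "v \<in> keys m")
    case True
    then have eq: "m = single v 1 + (m - single v 1)"
      by (intro poly_mapping_eqI) (auto simp: lookup_add lookup_minus lookup_single when_def in_keys_iff)
    have "keys (m - single v 1) \<subseteq> keys m"
      by (auto simp: in_keys_iff lookup_minus)
    then have "single (m - single v 1) c \<in> pvars (insert v W)"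
      using m by blast
    moreover have "single m c = 0 + var v * single (m - single v 1) c"
      by (subst eq) (simp add: var_def mult_single)
    ultimately show ?thesis
      using pvars_0 by blast
  next
    case False
    then show ?thesis
      using m by (intro bexI[of _ "single m c"] bexI[of _ 0]) auto
  qed
next
  case zero
  show ?case
    by (intro bexI[of _ 0]) auto
next
  case (add p q)
  then obtain p0 p1 q0 q1 where *: "p0 \<in> pvars W" "p1 \<in> pvars (insert v W)" "p = p0 + var v * p1"
    "q0 \<in> pvars W" "q1 \<in> pvars (insert v W)" "q = q0 + var v * q1"
    by blast
  then have "p + q = (p0 + q0) + var v * (p1 + q1)"
    by (simp add: algebra_simps)
  with * show ?case
    by blast
qed

lemma keys_var_power_mult:
  assumes "keys p \<subseteq> expmon (Suc v) ` E"
  shows "keys (var v ^ c * p) \<subseteq> expmon v ` (#) c ` E"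
proof
  fix m assume "m \<in> keys (var v ^ c * p)"
  then have "m \<in> (+) (single v c) ` keys p"
    using keys_mult[of "var v ^ c" p] by (auto simp: var_power)
  with assms obtain e where "e \<in> E" "m = expmon v (c # e)"
    by auto
  then show "m \<in> expmon v ` (#) c ` E"
    by blast
qed

lemma standard_monomials_span:
  assumes "1 \<le> k" "s \<le> k" "p \<in> pvars {v..<v + N}"
  shows "\<exists>b. keys b \<subseteq> expmon v ` stdexp k N s \<and> p - b \<in> idl {v..<v + N} (gens k v N s)"
  using assms(2,3)
proof (induction N arbitrary: v s p)
  case 0
  then have p: "keys p \<subseteq> {0}"
    by (force simp: pvars_def)
  show ?case
  proof (cases "s = 0")
    case True
    then show ?thesis
      using p by (intro exI[of _ p]) (auto intro: idl.zero)
  next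
    case False
    then have "1 \<in> gens k v 0 s"
      by (auto simp: gens_def)
    then have "p * 1 \<in> idl {v..<v + 0} (gens k v 0 s)"
      using 0 by (intro idl_generator_mult)
    then show ?thesis
      by (intro exI[of _ 0]) auto
  qed
next
  case (Suc N)
  let ?V = "{v..<v + Suc N}" and ?V' = "{Suc v..<Suc v + N}"
  let ?J = "idl ?V (gens k v (Suc N) s) :: 'a mpol set"
  let ?M = "expmon v ` stdexp k (Suc N) s"
  note IH = Suc.IH and s = Suc.prems(1)
  have ins: "insert v ?V' = ?V"
    by auto
  \<comment> \<open>Descending induction on the power of x, from x^k, which is a generator. In the
    layer x^c the part of \<open>p\<close> free of x is reduced by the outer hypothesis; the error
    and the part divisible by x both move to the layer x^(c+1).\<close>
  have "\<exists>b. keys b \<subseteq> ?M \<and> var v ^ (k - i) * p - b \<in> ?J" if "i \<le> k" "p \<in> pvars ?V" for i p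
    using that
  proof (induction i arbitrary: p)
    case 0
    have "hsym_on {v..<v + 1} k \<in> gens k v (Suc N) s"
      by (intro hsym_on_in_gens) auto
    then have "var v ^ k \<in> gens k v (Suc N) s"
      by (simp add: hsym_on_singleton)
    then have "p * var v ^ k \<in> ?J"
      using 0 by (intro idl_generator_mult)
    then show ?case
      by (intro exI[of _ 0]) (auto simp: mult.commute)
  next
    case (Suc i)
    define c where "c = k - Suc i"
    have c: "c < k" "k - i = Suc c"
      using Suc.prems by (auto simp: c_def)
    define s' where "s' = (if c < s then s - 1 else s)"
    have "s' \<le> k"
      using s by (auto simp: s'_def)
    obtain p0 p1 where p: "p0 \<in> pvars ?V'" "p1 \<in> pvars ?V" "p = p0 + var v * p1"
      using pvars_insert_decomp[of p v ?V', unfolded ins] Suc.prems by blast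
    obtain b0 where b0: "keys b0 \<subseteq> expmon (Suc v) ` stdexp k N s'"
        "p0 - b0 \<in> idl ?V' (gens k (Suc v) N s')"
      using IH[of s' p0 "Suc v"] p(1) \<open>s' \<le> k\<close> by blast
    obtain q where q: "q \<in> pvars ?V" "var v ^ c * (p0 - b0) - var v ^ Suc c * q \<in> ?J"
      using var_power_times_idl[OF assms(1) b0(2)[unfolded s'_def]] by blast
    obtain b1 where b1: "keys b1 \<subseteq> ?M" "var v ^ Suc c * (q + p1) - b1 \<in> ?J"
      using Suc.IH[of "q + p1"] Suc.prems q p c by auto
    have "(#) c ` stdexp k N s' \<subseteq> stdexp k (Suc N) s"
      using c by (auto simp: s'_def)
    then have "keys (var v ^ c * b0) \<subseteq> ?M"
      using keys_var_power_mult[OF b0(1), of c] by blast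
    then have "keys (var v ^ c * b0 + b1) \<subseteq> ?M"
      using b1(1) keys_add[of "var v ^ c * b0" b1] by blast
    moreover have "var v ^ c * p - (var v ^ c * b0 + b1)
        = (var v ^ c * (p0 - b0) - var v ^ Suc c * q) + (var v ^ Suc c * (q + p1) - b1)"
      by (simp add: p algebra_simps)
    moreover have "\<dots> \<in> ?J"
      by (intro idl_add q b1)
    ultimately show ?case
      unfolding c_def[symmetric] by metis
  qed
  from this[of k p] Suc.prems show ?case
    by auto
qed

section \<open>Standard monomials are independent on a finite set of points\<close>

text \<open>When s + 1 drops to s, only the first exponent c = s changes its branch. It is allowed
  in the second one because s < k, and the set of tails is \<open>stdexp k N s\<close> in
  both.\<close>

lemma stdexp_antimono: "Suc s \<le> k \<Longrightarrow> stdexp k N (Suc s) \<subseteq> stdexp k N s"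
proof (induction N arbitrary: s)
  case (Suc N)
  show ?case
  proof
    fix l assume "l \<in> stdexp k (Suc N) (Suc s)"
    then obtain c e where l: "l = c # e"
        and "c < Suc s \<and> e \<in> stdexp k N s \<or> Suc s \<le> c \<and> c < k \<and> e \<in> stdexp k N (Suc s)"
      by auto
    moreover have "stdexp k N s \<subseteq> stdexp k N (s - 1)"
      using Suc.IH[of "s - 1"] Suc.prems by (cases s) auto
    ultimately show "l \<in> stdexp k (Suc N) s"
      using Suc.IH[OF Suc.prems] Suc.prems by (auto simp: less_Suc_eq)
  qed
qed auto

lemma stdexp_antimono_pred: "s \<le> k \<Longrightarrow> stdexp k N s \<subseteq> stdexp k N (s - 1)"
  using stdexp_antimono[of "s - 1" k N] by (cases s) auto

lemma finite_stdexp [simp]: "finite (stdexp k N s)"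
proof (induction N arbitrary: s)
  case (Suc N)
  have "stdexp k (Suc N) s \<subseteq> (\<lambda>(c, e). c # e) ` ({..<s + k} \<times> (stdexp k N (s - 1) \<union> stdexp k N s))"
    by force
  then show ?case
    by (rule finite_subset) (auto intro: Suc.IH)
qed auto

lemma length_stdexp: "e \<in> stdexp k N s \<Longrightarrow> length e = N"
  by (induction N arbitrary: s e) (auto split: if_splits)

lemma keys_expmon: "keys (expmon v e) \<subseteq> {v..<v + length e}"
proof (induction e arbitrary: v)
  case (Cons c e)
  from Cons.IH[of "Suc v"] show ?case
    by (fastforce split: if_splits)
qed auto

lemma lookup_expmon_less: "w < v \<Longrightarrow> lookup (expmon v e) w = 0"
  using keys_expmon[of v e] by (force simp: in_keys_iff)

lemma expmon_eq_iff:
  assumes "length e = length e'"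
  shows "expmon v e = expmon v e' \<longleftrightarrow> e = e'"
  using assms
proof (induction e e' arbitrary: v rule: list_induct2)
  case (Cons c e c' e')
  have "c = c'" if "expmon v (c # e) = expmon v (c' # e')"
    using arg_cong[OF that, of "\<lambda>m. lookup m v"] by (simp add: lookup_add lookup_expmon_less)
  with Cons show ?case
    by auto
qed simp

lemma inj_on_expmon: "inj_on (expmon v) (stdexp k N s)"
  by (auto intro!: inj_onI simp: length_stdexp expmon_eq_iff)

lemma mdeg_expmon: "mdeg (expmon v e) = sum_list e"
  by (induction e arbitrary: v) auto

lemma monom_value_expmon_upd:
  "w < v \<Longrightarrow> monom_value (x(w := y)) (expmon v e) = monom_value x (expmon v e)"
  unfolding monom_value_def using keys_expmon[of v e] by (intro prod.cong) auto

lemma poly_function_zero: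
  fixes b :: "nat \<Rightarrow> 'a::field"
  assumes "finite T" "n \<le> card T" "\<And>y. y \<in> T \<Longrightarrow> (\<Sum>c<n. b c * y ^ c) = 0" "c < n"
  shows "b c = 0"
proof -
  define p where "p = (\<Sum>c<n. monom (b c) c)"
  have coeff_p: "coeff p i = (if i < n then b i else 0)" for i
    by (simp add: p_def coeff_sum)
  have "p = 0"
  proof (rule ccontr)
    assume "p \<noteq> 0"
    then have "card {y. poly p y = 0} \<le> degree p" "finite {y. poly p y = 0}"
      by (auto intro: card_poly_roots_bound poly_roots_finite)
    moreover have "T \<subseteq> {y. poly p y = 0}"
      using assms(3) by (auto simp: p_def poly_sum poly_monom)
    ultimately have "n \<le> degree p"
      using assms(2) card_mono[of "{y. poly p y = 0}" T] by linarith
    then have "lead_coeff p = 0"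
      by (simp add: coeff_p)
    with \<open>p \<noteq> 0\<close> show False
      by simp
  qed
  then show ?thesis
    using coeff_p[of c] assms(4) by simp
qed

text \<open>Read from left to right, a point picks a letter of the current alphabet, which is then
  replaced by a fresh one; all letters of \<open>T\<close> have to be picked.\<close>

fun zpt :: "(nat \<Rightarrow> 'a) \<Rightarrow> nat \<Rightarrow> nat \<Rightarrow> 'a set \<Rightarrow> 'a set \<Rightarrow> (nat \<Rightarrow> 'a) \<Rightarrow> bool" where
  "zpt \<beta> 0 v A T x \<longleftrightarrow> T = {}"
| "zpt \<beta> (Suc N) v A T x \<longleftrightarrow>
     x v \<in> A \<and> zpt \<beta> N (Suc v) (insert (\<beta> v) (A - {x v})) (T - {x v}) x"

lemma zpt_upd: "w < v \<Longrightarrow> zpt \<beta> N v A T (x(w := y)) = zpt \<beta> N v A T x"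
  by (induction N arbitrary: v A T) auto

text \<open>Slice by the first coordinate y: the coefficient of each tail monomial \<open>e\<close>
  is a polynomial \<open>Q e\<close> in y of degree below k. The slices y in T kill the tails that
  only occur with c < s; then the other slices can be treated with the smaller set of tails, and
  finally \<open>Q e\<close> has all k letters as roots.\<close>

lemma standard_monomials_independent_on_points:
  fixes a :: "nat list \<Rightarrow> 'a::field"
  assumes "inj \<beta>" "finite A" "card A = k" "T \<subseteq> A" "\<And>w. v \<le> w \<Longrightarrow> \<beta> w \<notin> A"
    and "\<And>x. zpt \<beta> N v A T x \<Longrightarrow>
      (\<Sum>e\<in>stdexp k N (card T). a e * monom_value x (expmon v e)) = 0"
    and "e \<in> stdexp k N (card T)"
  shows "a e = 0"
  using assms(2-)
proof (induction N arbitrary: v A T a e)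
  case 0
  then have "card T = 0" "e = []"
    by (auto split: if_splits)
  moreover have "finite T"
    using "0.prems" finite_subset by blast
  ultimately show ?case
    using "0.prems"(5)[of undefined] by simp
next
  case (Suc N)
  define s where "s = card T"
  define L where "L = stdexp k N (s - 1)"
  define b where "b c e = (if c # e \<in> stdexp k (Suc N) s then a (c # e) else 0)" for c e
  define Q where "Q e y = (\<Sum>c<k. b c e * y ^ c)" for e y
  have fT: "finite T"
    using Suc.prems finite_subset by auto
  have s: "s \<le> k"
    unfolding s_def using Suc.prems by (metis card_mono)
  have sub: "stdexp k N s \<subseteq> L"
    unfolding L_def by (rule stdexp_antimono_pred[OF s])
  have inL: "c < k \<and> e \<in> L" if "c # e \<in> stdexp k (Suc N) s" for c e
    using that s sub by (auto simp: L_def)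
  have vanish: "(\<Sum>e\<in>L. Q e y * monom_value x (expmon (Suc v) e)) = 0"
    if "y \<in> A" "zpt \<beta> N (Suc v) (insert (\<beta> v) (A - {y})) (T - {y}) x" for x y
  proof -
    have "(\<Sum>e\<in>L. Q e y * monom_value x (expmon (Suc v) e))
        = (\<Sum>e\<in>L. \<Sum>c<k. b c e * (y ^ c * monom_value x (expmon (Suc v) e)))"
      by (simp add: Q_def sum_distrib_right mult.assoc)
    also have "\<dots> = (\<Sum>c<k. \<Sum>e\<in>L. b c e * (y ^ c * monom_value x (expmon (Suc v) e)))"
      by (rule sum.swap)
    also have "\<dots> = (\<Sum>(c, e)\<in>{..<k} \<times> L. b c e * (y ^ c * monom_value x (expmon (Suc v) e)))"
      by (rule sum.cartesian_product)
    also have "\<dots> = (\<Sum>(c, e)\<in>{..<k} \<times> L. b c e * monom_value (x(v := y)) (expmon v (c # e)))"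
      by (intro sum.cong) (auto simp: monom_value_add monom_value_expmon_upd)
    also have "\<dots> = (\<Sum>l\<in>(\<lambda>(c, e). c # e) ` ({..<k} \<times> L).
        (if l \<in> stdexp k (Suc N) s then a l else 0) * monom_value (x(v := y)) (expmon v l))"
      by (subst sum.reindex) (auto intro!: inj_onI sum.cong simp: b_def simp del: stdexp.simps)
    also have "\<dots> = (\<Sum>l\<in>stdexp k (Suc N) s. a l * monom_value (x(v := y)) (expmon v l))"
    proof (rule sum.mono_neutral_cong_right)
      show "stdexp k (Suc N) s \<subseteq> (\<lambda>(c, e). c # e) ` ({..<k} \<times> L)"
      proof
        fix l assume l: "l \<in> stdexp k (Suc N) s"
        then obtain c e where "l = c # e"
          by auto
        with l inL[of c e] show "l \<in> (\<lambda>(c, e). c # e) ` ({..<k} \<times> L)"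
          by force
      qed
    qed (auto simp: L_def simp del: stdexp.simps)
    also have "\<dots> = 0"
      unfolding s_def using that by (intro Suc.prems(5)) (simp add: zpt_upd fun_upd_same del: fun_upd_apply)
    finally show ?thesis .
  qed
  have A': "finite (insert (\<beta> v) (A - {y}))" "card (insert (\<beta> v) (A - {y})) = k" if "y \<in> A" for y
    using that Suc.prems(1-4) card_Suc_Diff1[of A y] by (auto simp: card_insert_if)
  have fresh: "\<beta> w \<notin> insert (\<beta> v) (A - {y})" if "Suc v \<le> w" for y w
    using that Suc.prems(4) \<open>inj \<beta>\<close> by (auto simp: inj_eq)
  \<comment> \<open>Picking y from T leaves s - 1 letters to cover, so the induction hypothesis
    handles all tails in \<open>L\<close>.\<close>
  have QT: "Q e y = 0" if "y \<in> T" "e \<in> L" for e y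
  proof -
    have y: "y \<in> A"
      using that Suc.prems by auto
    have "card (T - {y}) = s - 1"
      using that fT by (simp add: s_def)
    then show ?thesis
      using that y Suc.prems(3) vanish[OF y] A'[OF y] fresh
      by (intro Suc.IH[of "insert (\<beta> v) (A - {y})" "T - {y}" "Suc v" "\<lambda>e. Q e y"]) (auto simp: L_def)
  qed
  \<comment> \<open>Such a tail can follow only c < s, so \<open>Q e\<close> has degree below s
    while the s elements of T are roots.\<close>
  have b_out: "b c e = 0" if "e \<in> L" "e \<notin> stdexp k N s" for c e
  proof (cases "c < s")
    case True
    have high: "b c e = 0" if "s \<le> c" for c
      using that \<open>e \<notin> stdexp k N s\<close> by (auto simp: b_def)
    have "(\<Sum>c<s. b c e * y ^ c) = Q e y" for y
      unfolding Q_def using s high by (intro sum.mono_neutral_left) auto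
    then show ?thesis
      using QT \<open>e \<in> L\<close> fT True by (intro poly_function_zero[of T s "\<lambda>c. b c e"]) (auto simp: s_def)
  next
    case False
    then show ?thesis
      using that by (auto simp: b_def)
  qed
  have QA: "Q e y = 0" if "y \<in> A" "e \<in> stdexp k N s" for e y
  proof (cases "y \<in> T")
    case True
    then show ?thesis
      using QT that sub by blast
  next
    case False
    have "(\<Sum>e\<in>stdexp k N s. Q e y * monom_value x (expmon (Suc v) e))
        = (\<Sum>e\<in>L. Q e y * monom_value x (expmon (Suc v) e))" for x
      using sub b_out by (intro sum.mono_neutral_left) (auto simp: L_def Q_def)
    then show ?thesis
      using that False vanish[OF that(1)] A'[OF that(1)] fresh Suc.prems(3)
      by (intro Suc.IH[of "insert (\<beta> v) (A - {y})" T "Suc v" "\<lambda>e. Q e y"]) (auto simp: s_def)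
  qed
  have "b c e = 0" if "c < k" "e \<in> stdexp k N s" for c e
    using that QA Suc.prems
    by (intro poly_function_zero[of A k "\<lambda>c. b c e"]) (auto simp: Q_def)
  moreover obtain c e' where e: "e = c # e'" "c # e' \<in> stdexp k (Suc N) s"
    using Suc.prems(6) by (auto simp: s_def)
  ultimately have "b c e' = 0"
    using inL[OF e(2)] b_out by blast
  then show ?case
    using e by (simp add: b_def del: stdexp.simps)
qed

lemma keys_standard_zero:
  fixes p :: "'a::field mpol"
  assumes "inj \<beta>" "finite A" "card A = k" "T \<subseteq> A" "\<And>w. v \<le> w \<Longrightarrow> \<beta> w \<notin> A"
    and keys: "keys p \<subseteq> expmon v ` stdexp k N (card T)"
    and zero: "\<And>x. zpt \<beta> N v A T x \<Longrightarrow> mpeval x p = 0"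
  shows "p = 0"
proof -
  have "lookup p (expmon v e) = 0" if "e \<in> stdexp k N (card T)" for e
  proof (rule standard_monomials_independent_on_points[where a = "\<lambda>e. lookup p (expmon v e)" and N = N,
        OF assms(1-5)])
    fix x assume x: "zpt \<beta> N v A T x"
    have "mpeval x p = (\<Sum>m\<in>expmon v ` stdexp k N (card T). lookup p m * monom_value x m)"
      by (rule mpeval.mlift_superset[OF _ keys]) simp
    also have "\<dots> = (\<Sum>e\<in>stdexp k N (card T). lookup p (expmon v e) * monom_value x (expmon v e))"
      by (subst sum.reindex[OF inj_on_expmon]) simp
    finally show "\<dots> = 0"
      using zero[OF x] by simp
  qed (use that in auto)
  then show ?thesis
    using keys by (intro poly_mapping_eqI) (auto simp: in_keys_iff)
qed

section \<open>Deforming the generators\<close>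

text \<open>The last pick brings in no letter that is used yet: j + 1 picks see only j fresh
  letters. This off-by-one decides the degree count in \<open>gens_deformation\<close>.\<close>

lemma zpt_image:
  assumes "inj \<beta>" "\<And>w. v \<le> w \<Longrightarrow> \<beta> w \<notin> A" "zpt \<beta> N v A T x" "j < N"
  shows "x ` {v..<v + Suc j} \<subseteq> A \<union> \<beta> ` {v..<v + j}"
  using assms(2-)
proof (induction N arbitrary: v A T j)
  case (Suc N)
  let ?A = "insert (\<beta> v) (A - {x v})"
  show ?case
  proof (cases j)
    case 0
    with Suc.prems show ?thesis
      by auto
  next
    case (Suc i)
    have "x ` {Suc v..<Suc v + Suc i} \<subseteq> ?A \<union> \<beta> ` {Suc v..<Suc v + i}"
      using Suc.prems \<open>inj \<beta>\<close> Suc by (intro Suc.IH[of "Suc v" ?A "T - {x v}" i]) (auto simp: inj_eq)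
    moreover have "{v..<v + Suc j} = insert v {Suc v..<Suc v + Suc i}"
      "{v..<v + j} = insert v {Suc v..<Suc v + i}"
      using Suc by auto
    ultimately show ?thesis
      using Suc.prems by auto
  qed
qed simp

text \<open>A picked letter leaves the alphabet and never returns, since all later additions are
  fresh.\<close>

lemma zpt_inj_on:
  assumes "inj \<beta>" "\<And>w. v \<le> w \<Longrightarrow> \<beta> w \<notin> A" "zpt \<beta> N v A T x"
  shows "inj_on x {v..<v + N}"
  using assms(2-)
proof (induction N arbitrary: v A T)
  case (Suc N)
  let ?A = "insert (\<beta> v) (A - {x v})"
  have A: "\<And>w. Suc v \<le> w \<Longrightarrow> \<beta> w \<notin> ?A" and z: "zpt \<beta> N (Suc v) ?A (T - {x v}) x" and v: "x v \<in> A"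
    using Suc.prems \<open>inj \<beta>\<close> by (auto simp: inj_eq)
  have "x v \<notin> x ` {Suc v..<Suc v + N}"
  proof (cases N)
    case (Suc j)
    then have "x ` {Suc v..<Suc v + N} \<subseteq> ?A \<union> \<beta> ` {Suc v..<Suc v + j}"
      using zpt_image[OF \<open>inj \<beta>\<close> A z, of j] by simp
    then show ?thesis
      using Suc.prems(1) v by fastforce
  qed simp
  moreover have "{v..<v + Suc N} = insert v {Suc v..<Suc v + N}"
    by auto
  ultimately show ?case
    using Suc.IH[OF A z] by simp
qed simp

lemma zpt_covers: "zpt \<beta> N v A T x \<Longrightarrow> T \<subseteq> x ` {v..<v + N}"
proof (induction N arbitrary: v A T)
  case (Suc N)
  have "T - {x v} \<subseteq> x ` {Suc v..<Suc v + N}"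
    using Suc.IH[of "Suc v" "insert (\<beta> v) (A - {x v})" "T - {x v}"] Suc.prems by simp
  moreover have "{v..<v + Suc N} = insert v {Suc v..<Suc v + N}"
    by auto
  ultimately show ?case
    by auto
qed simp

section \<open>Generating functions of the symmetric polynomials\<close>

lemma fps_prod_linear_nth_0:
  fixes f :: "'b \<Rightarrow> 'a::field"
  shows "finite U \<Longrightarrow> fps_nth (\<Prod>u\<in>U. 1 + fps_const (f u) * fps_X) 0 = 1"
  by (induction U rule: finite_induct) auto

lemma fps_prod_linear_nth_eq_0:
  fixes f :: "'b \<Rightarrow> 'a::field"
  assumes "finite U" "card U < r"
  shows "fps_nth (\<Prod>u\<in>U. 1 + fps_const (f u) * fps_X) r = 0"
  using assms
proof (induction U arbitrary: r rule: finite_induct)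
  case (insert u U)
  then obtain r' where "r = Suc r'" "card U < r'" "card U < r"
    by (cases r) auto
  with insert show ?case
    by (simp add: distrib_right mult.assoc)
qed simp

lemma mpeval_1 [simp]: "mpeval x 1 = 1"
  using mpeval_const[of x 1] by simp

lemma fps_hsym_on:
  fixes x :: "nat \<Rightarrow> 'a::field"
  assumes "finite W"
  shows "Abs_fps (\<lambda>k. mpeval x (hsym_on W k)) * (\<Prod>i\<in>W. 1 + fps_const (- x i) * fps_X) = 1"
  using assms
proof induction
  case empty
  have "mpeval x (hsym_on {} k) = (if k = 0 then 1 else 0)" for k
    by (cases k) (auto simp: hsym_on_empty)
  then show ?case
    by (auto simp: fps_eq_iff)
next
  case (insert v W)
  let ?H = "\<lambda>W. Abs_fps (\<lambda>k. mpeval x (hsym_on W k))" and ?L = "\<lambda>i. 1 + fps_const (- x i) * fps_X"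
  have LH: "?L v * ?H (insert v W) = ?H W"
  proof (rule fps_ext)
    fix n
    show "fps_nth (?L v * ?H (insert v W)) n = fps_nth (?H W) n"
      using insert.hyps by (cases n) (simp_all add: distrib_right mult.assoc hsym_on_insert)
  qed
  have "?H (insert v W) * (?L v * prod ?L W) = (?L v * ?H (insert v W)) * prod ?L W"
    by (simp only: ac_simps)
  also have "\<dots> = ?H W * prod ?L W"
    by (simp only: LH)
  finally have "?H (insert v W) * (?L v * prod ?L W) = ?H W * prod ?L W" .
  with insert show ?case
    by simp
qed

lemma fps_esym_on:
  fixes x :: "nat \<Rightarrow> 'a::field"
  assumes "finite W"
  shows "Abs_fps (\<lambda>r. mpeval x (esym_on W r)) = (\<Prod>i\<in>W. 1 + fps_const (x i) * fps_X)"
  using assms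
proof induction
  case empty
  have "mpeval x (esym_on {} k) = (if k = 0 then 1 else 0)" for k
    by (cases k) (auto simp: esym_on_eq_0)
  then show ?case
    by (auto simp: fps_eq_iff)
next
  case (insert v W)
  have "Abs_fps (\<lambda>k. mpeval x (esym_on (insert v W) k))
      = (1 + fps_const (x v) * fps_X) * Abs_fps (\<lambda>k. mpeval x (esym_on W k))" (is "?L = ?R")
  proof (rule fps_ext)
    fix n
    show "fps_nth ?L n = fps_nth ?R n"
      using insert.hyps by (cases n) (simp_all add: distrib_right esym_on_insert mult.assoc)
  qed
  with insert show ?case
    by simp
qed

text \<open>The coefficient at t^r of a(t) times the generating series of \<open>g\<close>. If
  \<open>a\<close> has constant term 1 and each \<open>g i\<close> is homogeneous of degree
  \<open>i\<close>, the leading form is \<open>g r\<close>; the other coefficients of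
  \<open>a\<close> are free to enforce vanishing on the points.\<close>

definition deform :: "'a::field fps \<Rightarrow> (nat \<Rightarrow> 'a mpol) \<Rightarrow> nat \<Rightarrow> 'a mpol" where
  "deform a g r = (\<Sum>i\<le>r. single 0 (fps_nth a i) * g (r - i))"

lemma mpeval_deform: "mpeval x (deform a g r) = fps_nth (a * Abs_fps (\<lambda>r. mpeval x (g r))) r"
  by (simp add: deform_def fps_mult_nth atMost_atLeast0)

lemma deform_pvars:
  assumes "\<And>i. g i \<in> pvars W"
  shows "deform a g r \<in> pvars W"
  unfolding deform_def using assms by (intro pvars_sum pvars_mult pvars_single) auto

lemma deform_lower_deg:
  assumes "fps_nth a 0 = 1" "\<And>i. g i \<in> pvars W" "\<And>i. g i \<in> hom_of_deg i"
  shows "deform a g r - g r \<in> lower_deg W r"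
proof -
  have "deform a g r = g r + (\<Sum>i=1..r. single 0 (fps_nth a i) * g (r - i))"
    unfolding deform_def using assms(1) by (simp add: atMost_atLeast0 sum.atLeast_Suc_atMost)
  moreover have "single 0 (fps_nth a i) * g (r - i) \<in> lower_deg W r" if "i \<in> {1..r}" for i
  proof -
    have "single 0 (fps_nth a i) * g (r - i) \<in> hom_of_deg (0 + (r - i))"
      by (intro hom_of_deg_mult assms hom_of_deg_single) auto
    moreover have "single 0 (fps_nth a i) * g (r - i) \<in> pvars W"
      by (intro pvars_mult assms pvars_single) auto
    ultimately show ?thesis
      using that by (auto simp: lower_deg_def hom_of_deg_def)
  qed
  ultimately show ?thesis
    by (auto intro: lower_deg_sum)
qed

lemma gens_deformation:
  fixes g :: "'a::field mpol"
  assumes "1 \<le> k" "inj \<beta>" "finite A" "card A = k" "T \<subseteq> A" "\<And>w. v \<le> w \<Longrightarrow> \<beta> w \<notin> A"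
    and g: "g \<in> gens k v N (card T)"
  shows "\<exists>e h. g \<in> hom_of_deg e \<and> h \<in> pvars {v..<v + N} \<and>
    (\<forall>x. zpt \<beta> N v A T x \<longrightarrow> mpeval x h = 0) \<and> h - g \<in> lower_deg {v..<v + N} e"
  using g unfolding gens_def
proof (elim UnE CollectE exE conjE)
  fix j assume g: "g = hsym_on {v..<v + j} k" and "1 \<le> j" "j \<le> N"
  then obtain i where i: "j = Suc i" "i < N"
    by (cases j) auto
  \<comment> \<open>All values that the first j variables can take, k + j - 1 in number. At a point,
    j distinct factors of \<open>a\<close> cancel against the series of the h's, leaving a
    polynomial of degree at most k - 1.\<close>
  define U where "U = A \<union> \<beta> ` {v..<v + i}"
  define a where "a = (\<Prod>u\<in>U. 1 + fps_const (- u) * fps_X)"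
  have fU: "finite U"
    using assms by (simp add: U_def)
  have card_U: "card U = k + i"
    unfolding U_def using assms
    by (subst card_Un_disjoint) (auto simp: card_image[OF inj_on_subset[OF \<open>inj \<beta>\<close>]])
  have "mpeval x (deform a (hsym_on {v..<v + j}) k) = 0" if z: "zpt \<beta> N v A T x" for x
  proof -
    let ?X = "x ` {v..<v + j}"
    have sub: "?X \<subseteq> U"
      unfolding U_def i using zpt_image[OF assms(2,6) z] i by blast
    have inj: "inj_on x {v..<v + j}"
      using zpt_inj_on[OF assms(2,6) z] \<open>j \<le> N\<close> by (auto elim: inj_on_subset)
    have "a = (\<Prod>u\<in>U - ?X. 1 + fps_const (- u) * fps_X) * (\<Prod>u\<in>?X. 1 + fps_const (- u) * fps_X)"
      unfolding a_def by (rule prod.subset_diff[OF sub fU])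
    also have "(\<Prod>u\<in>?X. 1 + fps_const (- u) * fps_X) = (\<Prod>i\<in>{v..<v + j}. 1 + fps_const (- x i) * fps_X)"
      by (simp add: prod.reindex[OF inj])
    finally have "a * Abs_fps (\<lambda>r. mpeval x (hsym_on {v..<v + j} r))
        = (\<Prod>u\<in>U - ?X. 1 + fps_const (- u) * fps_X)"
      using fps_hsym_on[of "{v..<v + j}" x] by (simp add: mult.commute mult.left_commute)
    moreover have "card (U - ?X) = k - 1"
      using card_U card_image[OF inj] card_Diff_subset[OF _ sub] i by simp
    ultimately show ?thesis
      using fps_prod_linear_nth_eq_0[of "U - ?X" k uminus] fU \<open>1 \<le> k\<close> by (simp add: mpeval_deform)
  qed
  moreover have "deform a (hsym_on {v..<v + j}) k - g \<in> lower_deg {v..<v + N} k"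
    unfolding g using fps_prod_linear_nth_0[OF fU, of uminus] \<open>j \<le> N\<close>
    by (intro deform_lower_deg) (auto simp: a_def hsym_on_hom)
  moreover have "deform a (hsym_on {v..<v + j}) k \<in> pvars {v..<v + N}"
    using \<open>j \<le> N\<close> by (intro deform_pvars) auto
  ultimately show ?thesis
    using g hsym_on_hom by blast
next
  fix r assume g: "g = esym_on {v..<v + N} r" and "r \<le> N" and r: "N < r + card T"
  define b :: "'a fps" where "b = (\<Prod>u\<in>T. 1 + fps_const u * fps_X)"
  \<comment> \<open>At a point the letters of \<open>T\<close> all occur among the distinct values,
    so \<open>b\<close> divides the product of the 1 + x_i t, and the quotient has degree at most N
    - |T| < r.\<close>
  define a where "a = inverse b"
  have fT: "finite T"
    using assms finite_subset by auto
  have b0: "fps_nth b 0 = 1"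
    unfolding b_def by (rule fps_prod_linear_nth_0[OF fT])
  then have ab: "a * b = 1"
    unfolding a_def by (intro inverse_mult_eq_1) simp
  have a0: "fps_nth a 0 = 1"
    using b0 by (simp add: a_def)
  have "mpeval x (deform a (esym_on {v..<v + N}) r) = 0" if z: "zpt \<beta> N v A T x" for x
  proof -
    let ?X = "x ` {v..<v + N}"
    have sub: "T \<subseteq> ?X"
      by (rule zpt_covers[OF z])
    have inj: "inj_on x {v..<v + N}"
      by (rule zpt_inj_on[OF assms(2,6) z])
    have "Abs_fps (\<lambda>r. mpeval x (esym_on {v..<v + N} r)) = (\<Prod>u\<in>?X. 1 + fps_const u * fps_X)"
      by (simp add: fps_esym_on prod.reindex[OF inj])
    also have "\<dots> = (\<Prod>u\<in>?X - T. 1 + fps_const u * fps_X) * b"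
      unfolding b_def by (rule prod.subset_diff[OF sub]) simp
    finally have "a * Abs_fps (\<lambda>r. mpeval x (esym_on {v..<v + N} r))
        = (\<Prod>u\<in>?X - T. 1 + fps_const u * fps_X)"
      using ab by (simp add: mult.left_commute)
    moreover have "card (?X - T) = N - card T"
      using card_image[OF inj] card_Diff_subset[OF fT sub] by simp
    moreover have "card T \<le> N"
      using card_image[OF inj] card_mono[OF _ sub] by simp
    ultimately show ?thesis
      using fps_prod_linear_nth_eq_0[of "?X - T" r "\<lambda>u. u"] r by (simp add: mpeval_deform)
  qed
  moreover have "deform a (esym_on {v..<v + N}) r - g \<in> lower_deg {v..<v + N} r"
    unfolding g using a0 by (intro deform_lower_deg) (auto simp: esym_on_hom)
  moreover have "deform a (esym_on {v..<v + N}) r \<in> pvars {v..<v + N}"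
    by (intro deform_pvars) auto
  moreover have "g \<in> hom_of_deg r"
    unfolding g by (rule esym_on_hom) simp
  ultimately show ?thesis
    by blast
qed

section \<open>Standard monomials are independent modulo the ideal\<close>

text \<open>The degree d part of a sum of terms c g is the sum of the terms c' g with c' the
  component of c of complementary degree. Replacing each g by its deformation changes only lower
  degrees. Cancellation in top degree does no harm, as the component of the prescribed degree d is
  followed throughout, even if it is zero.\<close>

lemma idl_deformation:
  fixes G :: "'a::field mpol set"
  assumes "\<And>g. g \<in> G \<Longrightarrow> \<exists>e h. g \<in> hom_of_deg e \<and> h \<in> pvars W \<and>
      (\<forall>x. Z x \<longrightarrow> mpeval x h = 0) \<and> h - g \<in> lower_deg W e"
    and "f \<in> idl W G"
  shows "hcomp d f \<in> idl W G \<and>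
    (\<exists>h\<in>pvars W. (\<forall>x. Z x \<longrightarrow> mpeval x h = 0) \<and> h - hcomp d f \<in> lower_deg W d)"
  using assms(2)
proof induction
  case zero
  show ?case
    by (auto intro!: idl.zero bexI[of _ 0])
next
  case (step p c g)
  then obtain h where h: "h \<in> pvars W" "\<forall>x. Z x \<longrightarrow> mpeval x h = 0" "h - hcomp d p \<in> lower_deg W d"
    by blast
  obtain e h' where h': "g \<in> hom_of_deg e" "h' \<in> pvars W" "\<forall>x. Z x \<longrightarrow> mpeval x h' = 0"
      "h' - g \<in> lower_deg W e"
    using assms(1)[OF step.hyps(3)] by blast
  show ?case
  proof (cases "e \<le> d")
    case True
    let ?c = "hcomp (d - e) c"
    have c: "?c \<in> pvars W"
      using step.hyps by auto
    have eq: "hcomp d (p + c * g) = hcomp d p + ?c * g"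
      using True by (simp add: hcomp_add hcomp_mult_hom[OF h'(1)])
    have "?c * (h' - g) \<in> lower_deg W (d - e + e)"
      by (intro lower_deg_mult c hcomp_hom h')
    then have "(h - hcomp d p) + ?c * (h' - g) \<in> lower_deg W d"
      using True by (intro lower_deg_add h) simp
    then have "(h + ?c * h') - hcomp d (p + c * g) \<in> lower_deg W d"
      by (simp add: eq algebra_simps)
    moreover have "h + ?c * h' \<in> pvars W" "\<forall>x. Z x \<longrightarrow> mpeval x (h + ?c * h') = 0"
      using h h' c by auto
    moreover have "hcomp d (p + c * g) \<in> idl W G"
      unfolding eq using step c by (intro idl.step) auto
    ultimately show ?thesis
      by blast
  next
    case False
    then have "hcomp d (p + c * g) = hcomp d p"
      by (simp add: hcomp_add hcomp_mult_hom[OF h'(1)])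
    with step show ?thesis
      by simp
  qed
qed

lemma gens_hom: "g \<in> gens k v N s \<Longrightarrow> \<exists>e. g \<in> hom_of_deg e"
  unfolding gens_def using hsym_on_hom esym_on_hom by blast

text \<open>With an empty set of points every generator serves as its own deformation, so the first
  half of \<open>idl_deformation\<close> applies.\<close>

lemma idl_hcomp:
  assumes "\<And>g. g \<in> G \<Longrightarrow> \<exists>e. g \<in> hom_of_deg e" "G \<subseteq> pvars W" "f \<in> idl W G"
  shows "hcomp d f \<in> idl W G"
proof -
  have "hcomp d f \<in> idl W G \<and>
      (\<exists>h\<in>pvars W. (\<forall>x. False \<longrightarrow> mpeval x h = 0) \<and> h - hcomp d f \<in> lower_deg W d)"
  proof (rule idl_deformation[OF _ assms(3)])
    fix g assume g: "g \<in> G"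
    then obtain e where "g \<in> hom_of_deg e"
      using assms(1) by blast
    with g assms(2) show "\<exists>e h. g \<in> hom_of_deg e \<and> h \<in> pvars W \<and> (\<forall>x. False \<longrightarrow> mpeval x h = 0) \<and>
        h - g \<in> lower_deg W e"
      by (intro exI[of _ e] exI[of _ g]) auto
  qed
  then show ?thesis
    by blast
qed

lemma hcomp_diff: "hcomp d (p - q) = hcomp d p - hcomp d q"
  by (rule poly_mapping_eqI) (simp add: lookup_hcomp lookup_minus)

lemma hcomp_lower: "p \<in> lower_deg W d \<Longrightarrow> hcomp d p = 0"
  by (rule poly_mapping_eqI) (auto simp: lookup_hcomp lower_deg_def in_keys_iff)

lemma lower_deg_Suc_minus_hcomp:
  assumes "p \<in> lower_deg W (Suc d)"
  shows "p - hcomp d p \<in> lower_deg W d"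
  unfolding lower_deg_def
proof (intro CollectI conjI ballI)
  show "p - hcomp d p \<in> pvars W"
    using assms by (auto simp: lower_deg_def)
  fix m assume "m \<in> keys (p - hcomp d p)"
  then have "m \<in> keys p" "mdeg m \<noteq> d"
    by (auto simp: in_keys_iff lookup_minus lookup_hcomp split: if_splits)
  then show "mdeg m < d"
    using assms by (auto simp: lower_deg_def less_Suc_eq)
qed

lemma keys_stdexp_pvars:
  assumes "keys b \<subseteq> expmon v ` stdexp k N s"
  shows "b \<in> pvars {v..<v + N}"
  unfolding pvars_def
proof (intro CollectI ballI)
  fix m assume "m \<in> keys b"
  then obtain e where "e \<in> stdexp k N s" "m = expmon v e"
    using assms by blast
  then show "keys m \<subseteq> {v..<v + N}"
    using keys_expmon[of v e] length_stdexp[of e k N s] by simp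
qed

text \<open>The points lie in the zero set of the deformed generators. An element of the ideal supported
  on standard monomials is therefore the leading form of a polynomial vanishing on all points whose
  lower terms can be reduced to standard monomials as well.\<close>

lemma standard_in_idl_zero_if_infinite:
  fixes b :: "'a::field mpol" and \<gamma> :: "nat \<Rightarrow> 'a"
  assumes "inj \<gamma>" "1 \<le> k"
    and b: "b \<in> idl {v..<v + N} (gens k v N k)" "b \<in> hom_of_deg d"
      "keys b \<subseteq> expmon v ` stdexp k N k"
  shows "b = 0"
proof -
  define A where "A = \<gamma> ` {..<k}"
  define \<beta> where "\<beta> i = \<gamma> (k + i)" for i
  let ?V = "{v..<v + N}" and ?M = "expmon v ` stdexp k N k"
  let ?J = "idl ?V (gens k v N k) :: 'a mpol set"
  define Z where "Z x \<longleftrightarrow> zpt \<beta> N v A A x" for x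
  have \<beta>: "inj \<beta>" and fresh: "\<And>w. \<beta> w \<notin> A"
    using \<open>inj \<gamma>\<close> by (auto simp: A_def \<beta>_def inj_eq intro!: injI)
  have A: "finite A" "card A = k"
    using card_image[OF inj_on_subset[OF \<open>inj \<gamma>\<close>], of "{..<k}"] by (simp_all add: A_def)
  have defo: "hcomp d f \<in> ?J \<and>
      (\<exists>h\<in>pvars ?V. (\<forall>x. Z x \<longrightarrow> mpeval x h = 0) \<and> h - hcomp d f \<in> lower_deg ?V d)"
    if "f \<in> ?J" for f d
    unfolding Z_def
    by (rule idl_deformation[OF gens_deformation[OF \<open>1 \<le> k\<close> \<beta> A order_refl fresh, unfolded A] that])
  \<comment> \<open>The degree bound on \<open>b\<close> is the point. Spanning alone may introduce
    terms of higher degree; so only the degree d component of the reduction is used, and its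
    difference from that of \<open>p\<close> is traded, on the points, for lower terms.\<close>
  have reduce: "\<exists>b. keys b \<subseteq> ?M \<and> b \<in> lower_deg ?V d \<and> (\<forall>x. Z x \<longrightarrow> mpeval x p = mpeval x b)"
    if "p \<in> lower_deg ?V d" for p d
    using that
  proof (induction d arbitrary: p)
    case 0
    then have "p = 0"
      by (auto simp: lower_deg_def in_keys_iff intro!: poly_mapping_eqI)
    then show ?case
      by (intro exI[of _ 0]) auto
  next
    case (Suc d)
    obtain b0 where b0: "keys b0 \<subseteq> ?M" "p - b0 \<in> ?J"
      using standard_monomials_span[OF \<open>1 \<le> k\<close> order_refl, of p v N] Suc.prems
      by (auto simp: lower_deg_def)
    obtain h where h: "\<forall>x. Z x \<longrightarrow> mpeval x h = 0" "h - (hcomp d p - hcomp d b0) \<in> lower_deg ?V d"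
      using defo[OF b0(2), of d] by (auto simp: hcomp_diff)
    obtain b1 where b1: "keys b1 \<subseteq> ?M" "b1 \<in> lower_deg ?V d"
        "\<forall>x. Z x \<longrightarrow> mpeval x ((p - hcomp d p) - (h - (hcomp d p - hcomp d b0))) = mpeval x b1"
      using Suc.IH[OF lower_deg_diff[OF lower_deg_Suc_minus_hcomp[OF Suc.prems] h(2)]] by blast
    have "hcomp d b0 \<in> lower_deg ?V (Suc d)"
      using keys_stdexp_pvars[OF b0(1)] by (auto simp: lower_deg_def keys_hcomp)
    then have "hcomp d b0 + b1 \<in> lower_deg ?V (Suc d)"
      using b1(2) by (intro lower_deg_add) (auto simp: lower_deg_def)
    moreover have "keys (hcomp d b0 + b1) \<subseteq> ?M"
      using keys_add[of "hcomp d b0" b1] b0(1) b1(1) by (auto simp: keys_hcomp)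
    moreover have "\<forall>x. Z x \<longrightarrow> mpeval x p = mpeval x (hcomp d b0 + b1)"
      using b1(3) h(1) by (auto simp: algebra_simps)
    ultimately show ?case
      by blast
  qed
  have hb: "hcomp d b = b"
    using b(2) by (simp add: hcomp_of_hom)
  obtain h where h: "\<forall>x. Z x \<longrightarrow> mpeval x h = 0" "h - b \<in> lower_deg ?V d"
    using defo[OF b(1), of d] by (auto simp: hb)
  obtain b1 where b1: "keys b1 \<subseteq> ?M" "b1 \<in> lower_deg ?V d" "\<forall>x. Z x \<longrightarrow> mpeval x (h - b) = mpeval x b1"
    using reduce[OF h(2)] by blast
  \<comment> \<open>On the points h vanishes, so \<open>b\<close> equals -(h - b), that is,
    -\<open>b1\<close>. Since \<open>b1\<close> has degree below d, it cannot cancel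
    \<open>b\<close>.\<close>
  have "b + b1 = 0"
  proof (rule keys_standard_zero[OF \<beta> A order_refl fresh, unfolded A])
    show "keys (b + b1) \<subseteq> ?M"
      using keys_add[of b b1] b(3) b1(1) by blast
    show "mpeval x (b + b1) = 0" if "zpt \<beta> N v A A x" for x
    proof -
      have "mpeval x b1 = - mpeval x b"
        using b1(3) h(1) that by (simp add: Z_def)
      then show ?thesis
        by simp
    qed
  qed
  then have "hcomp d (b + b1) = 0"
    by simp
  then show ?thesis
    using hb hcomp_lower[OF b1(2)] by (simp add: hcomp_add)
qed

section \<open>Extension of the coefficient field\<close>

lemma additive_0:
  fixes f :: "'a::ab_group_add \<Rightarrow> 'b::ab_group_add"
  assumes "\<And>a b. f (a + b) = f a + f b"
  shows "f 0 = 0"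
  using assms[of 0 0] by simp

text \<open>The generators only have coefficients 0 and 1, hence are carried to the generators over
  the larger field.\<close>

lemma map_coeffs_idl:
  fixes f :: "'a::field \<Rightarrow> 'b::field"
  assumes add: "\<And>a b. f (a + b) = f a + f b" and mult: "\<And>a b. f (a * b) = f a * f b" and one: "f 1 = 1"
    and p: "p \<in> idl W (gens k v N s)"
  shows "map_coeffs f p \<in> idl W (gens k v N s)"
proof -
  interpret ring_lift "\<lambda>a. single 0 (f a)" "\<lambda>m. single m 1 :: 'b mpol"
    rewrites "mlift (\<lambda>a. single 0 (f a)) (\<lambda>m. single m 1) = map_coeffs f"
    by unfold_locales (auto simp: add mult single_add mult_single map_coeffs_def)
  have f0: "f 0 = 0"
    by (rule additive_0) (rule add)
  have pv: "map_coeffs f q \<in> pvars W" if "q \<in> pvars W" for q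
    using that by (auto simp: pvars_def in_keys_iff lookup_map_coeffs[of f, OF f0] f0)
  have single: "map_coeffs f (single m 1) = single m 1" for m
    by (simp add: one mult_single)
  have prod: "map_coeffs f (prod var S) = prod var S" if "finite S" for S
    using that by induction (use single[of 0] in \<open>simp_all add: var_def one\<close>)
  have "map_coeffs f (hsym_on U k) = hsym_on U k" for U
    by (simp add: hsym_on_def one)
  moreover have "map_coeffs f (esym_on U r) = esym_on U r" if "finite U" for U r
    using finite_subset[OF _ that] by (simp add: esym_on_def prod)
  ultimately have "map_coeffs f g \<in> gens k v N s" if "g \<in> gens k v N s" for g
    using that unfolding gens_def by fastforce
  with p pv show ?thesis
    by induction (auto intro: idl.intros)
qed

lemma standard_in_idl_zero:
  fixes b :: "'a::field mpol"
  assumes "1 \<le> k" "b \<in> idl {v..<v + N} (gens k v N k)" "b \<in> hom_of_deg d"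
    "keys b \<subseteq> expmon v ` stdexp k N k"
  shows "b = 0"
proof -
  define f :: "'a \<Rightarrow> 'a poly fract" where "f a = Fract [:a:] 1" for a
  \<comment> \<open>The powers of the indeterminate give infinitely many letters, even over a finite
    field.\<close>
  define \<gamma> :: "nat \<Rightarrow> 'a poly fract" where "\<gamma> i = Fract (monom 1 i) 1" for i
  have "inj \<gamma>"
    by (auto intro!: injI simp: \<gamma>_def eq_fract monom_eq_iff')
  have add: "f (a + b) = f a + f b" and mult: "f (a * b) = f a * f b" for a b
    by (simp_all add: f_def mult.commute)
  have one: "f 1 = 1"
    by (simp add: f_def One_fract_def one_pCons)
  have f0: "f 0 = 0"
    by (rule additive_0) (rule add)
  have f_eq_0: "f a = 0 \<longleftrightarrow> a = 0" for a
    by (auto simp: f_def Zero_fract_def eq_fract)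
  have keys: "keys (map_coeffs f b) = keys b"
    by (auto simp: in_keys_iff lookup_map_coeffs[of f, OF f0] f_eq_0)
  have "map_coeffs f b = 0"
    using assms keys
    by (intro standard_in_idl_zero_if_infinite[OF \<open>inj \<gamma>\<close> \<open>1 \<le> k\<close>, of _ v N d] map_coeffs_idl add mult one)
       (auto simp: hom_of_deg_def)
  then have "f (lookup b m) = 0" for m
    using lookup_map_coeffs[of f b m, OF f0] by simp
  then show ?thesis
    by (intro poly_mapping_eqI) (simp add: f_eq_0)
qed

section \<open>Dimension count in each degree\<close>

lemma Jideal_eq_idl:
  assumes "k \<le> n"
  shows "Jideal n k = (idl {1..<1 + n} (gens k 1 n k) :: 'a::field mpol set)"
proof -
  have eq: "Jgens n k = (gens k 1 n k :: 'a mpol set)"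
  proof -
    have "hsym k j = (hsym_on {1..<1 + j} k :: 'a mpol)"
        "esym j n = (esym_on {1..<1 + n} j :: 'a mpol)" for j
      by (simp_all add: hsym_def hsym_on_def esym_def esym_on_def atLeastLessThanSuc_atLeastAtMost)
    moreover have "i \<in> {n - k + 1..n} \<longleftrightarrow> i \<le> n \<and> n < i + k" for i
      using assms by auto
    ultimately show ?thesis
      by (simp only: Jgens_def gens_def atLeastAtMost_iff)
  qed
  have "finite (Jgens n k :: 'a mpol set)"
    by (simp add: Jgens_def)
  from gen_ideal_eq_idl[OF this, of n] show ?thesis
    by (simp add: Jideal_def eq atLeastLessThanSuc_atLeastAtMost)
qed

lemma mscale_single: "mscale c (single m a) = single m (c * a)"
  by (simp add: mscale_def mult_single)

lemma lookup_mscale: "lookup (mscale c p) m = c * lookup p m"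
  by (induction p rule: poly_mapping_single_induct)
     (simp_all add: mscale_def mult_single lookup_single when_def lookup_add distrib_left)

text \<open>A basis \<open>C\<close> of the degree d part of the ideal and the standard monomials of
  degree d together form a basis of all forms of degree d. Hence the truncated subtraction in
  \<open>hilbS\<close> is exact.\<close>

lemma hilbS_eq_card:
  assumes "1 \<le> k" "k \<le> n"
  shows "hilbS TYPE('a::field) n k d = card {e \<in> stdexp k n k. sum_list e = d}"
proof -
  interpret vector_space "mscale :: 'a \<Rightarrow> 'a mpol \<Rightarrow> 'a mpol"
    by (rule mpol_vector_space)
  define M where "M = expmon 1 ` {e \<in> stdexp k n k. sum_list e = d}"
  define mon :: "(nat \<Rightarrow>\<^sub>0 nat) \<Rightarrow> 'a mpol" where "mon m = single m 1" for m
  define H :: "'a mpol set" where "H = homog n d"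
  define J :: "'a mpol set" where "J = Jideal n k \<inter> H"
  have I: "Jideal n k = (idl {1..<1 + n} (gens k 1 n k) :: 'a mpol set)"
    by (rule Jideal_eq_idl[OF assms(2)])
  have H: "H = pvars {1..<1 + n} \<inter> hom_of_deg d"
    by (simp add: H_def homog_eq atLeastLessThanSuc_atLeastAtMost)
  have inj_mon: "inj_on mon X" for X
    by (auto intro!: inj_onI simp: mon_def dest!: arg_cong[of _ _ keys])
  have span_mon: "p \<in> span (mon ` X)" if "keys p \<subseteq> X" for p X
  proof -
    have "p = (\<Sum>m\<in>keys p. mscale (lookup p m) (mon m))"
      using poly_mapping_sum_singles[of p] by (simp add: mon_def mscale_single)
    also have "\<dots> \<in> span (mon ` X)"
      using that by (intro span_sum span_scale span_base) auto
    finally show ?thesis .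
  qed
  have finM: "finite M"
    by (simp add: M_def)
  have cardM: "card (mon ` M) = card {e \<in> stdexp k n k. sum_list e = d}"
    unfolding M_def card_image[OF inj_mon] by (intro card_image inj_on_subset[OF inj_on_expmon]) auto
  have scale_pvars: "mscale c p \<in> pvars W" if "p \<in> pvars W" for c and p :: "'a mpol" and W
    using that unfolding mscale_def by (intro pvars_mult pvars_single) auto
  have scale_hom: "mscale c p \<in> hom_of_deg d" if "p \<in> hom_of_deg d" for c and p :: "'a mpol"
    using that by (auto simp: hom_of_deg_def in_keys_iff lookup_mscale)
  have scale_idl: "mscale c p \<in> Jideal n k" if "p \<in> Jideal n k" for c and p :: "'a mpol"
    using that unfolding I mscale_def by (intro idl_mult pvars_single) auto
  have idl_zero: "0 \<in> (Jideal n k :: 'a mpol set)"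
    unfolding I by (rule idl.zero)
  have idl_plus: "p + q \<in> Jideal n k" if "p \<in> Jideal n k" "q \<in> Jideal n k" for p q :: "'a mpol"
    using that unfolding I by (rule idl_add)
  have "subspace J"
    unfolding J_def H
    by (intro subspaceI)
       (auto intro: idl_zero idl_plus hom_of_deg_add scale_pvars scale_hom scale_idl)
  have zero: "p = 0" if "p \<in> J" "keys p \<subseteq> M" for p
    using that by (intro standard_in_idl_zero[OF assms(1), of p 1 n d]) (auto simp: J_def I H M_def)
  have monM: "mon ` M \<subseteq> H"
  proof
    fix p assume "p \<in> mon ` M"
    then obtain e where e: "e \<in> stdexp k n k" "sum_list e = d" "p = mon (expmon 1 e)"
      by (auto simp: M_def)
    then show "p \<in> H"
      using keys_expmon[of 1 e] length_stdexp[of e]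
      by (auto simp: H mon_def intro!: pvars_single hom_of_deg_single mdeg_expmon)
  qed
  obtain C where C: "C \<subseteq> J" "independent C" "J \<subseteq> span C" "card C = dim J"
    using basis_exists by blast
  have spanC: "span C \<subseteq> J"
    by (rule span_minimal[OF C(1) \<open>subspace J\<close>])
  have "finite C"
  proof -
    let ?E = "{m. keys m \<subseteq> {1..<1 + n} \<and> mdeg m = d}"
    have "J \<subseteq> span (mon ` ?E)"
      by (auto simp: J_def H pvars_def hom_of_deg_def intro!: span_mon)
    then show ?thesis
      using independent_span_bound[of "mon ` ?E" C] C finite_monomials by auto
  qed
  have disj: "C \<inter> mon ` M = {}"
  proof (rule ccontr)
    assume "C \<inter> mon ` M \<noteq> {}"
    then obtain m where "mon m \<in> C" "m \<in> M"
      by blast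
    then have "mon m = 0"
      using C(1) by (intro zero) (auto simp: mon_def)
    then show False
      by (auto simp: mon_def dest: arg_cong[of _ _ keys])
  qed
  have "independent (C \<union> mon ` M)"
  proof
    assume "dependent (C \<union> mon ` M)"
    then obtain u v where u: "v \<in> C \<union> mon ` M" "u v \<noteq> 0" "(\<Sum>v\<in>C \<union> mon ` M. mscale (u v) v) = 0"
      using \<open>finite C\<close> finM by (auto simp: dependent_finite)
    let ?c = "\<Sum>v\<in>C. mscale (u v) v" and ?b = "\<Sum>v\<in>mon ` M. mscale (u v) v"
    have sum0: "?c + ?b = 0"
      using u(3) \<open>finite C\<close> finM disj by (simp add: sum.union_disjoint)
    have b: "?b = (\<Sum>m\<in>M. single m (u (mon m)))"
      by (subst sum.reindex[OF inj_mon]) (simp add: mon_def mscale_single)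
    have lookup_b: "lookup ?b m = (if m \<in> M then u (mon m) else 0)" for m
      using finM by (auto simp: b lookup_sum lookup_single when_def)
    have "?c \<in> J"
      using spanC by (meson span_base span_scale span_sum subsetD)
    then have "- ?c \<in> J"
      using \<open>subspace J\<close> subspace_neg by blast
    moreover have "?b = - ?c"
      using sum0 by (simp add: eq_neg_iff_add_eq_0 add.commute)
    \<comment> \<open>The monomial part of the relation lies in the ideal and is supported on
      standard monomials, so it vanishes; what remains is a relation within
      \<open>C\<close>.\<close>
    ultimately have "?b \<in> J"
      by simp
    then have b0: "?b = 0"
      by (rule zero) (auto simp: in_keys_iff lookup_b split: if_splits)
    then have "u (mon m) = 0" if "m \<in> M" for m
      using lookup_b[of m] that by simp
    moreover have "u w = 0" if "w \<in> C" for w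
      using C(2) \<open>finite C\<close> sum0 b0 that by (auto simp: dependent_finite)
    ultimately show False
      using u by blast
  qed
  moreover have "H \<subseteq> span (C \<union> mon ` M)"
  proof
    fix p assume p: "p \<in> H"
    then obtain b where b: "keys b \<subseteq> expmon 1 ` stdexp k n k" "p - b \<in> idl {1..<1 + n} (gens k 1 n k)"
      using standard_monomials_span[OF assms(1) order_refl, of p 1 n] by (auto simp: H)
    have "hcomp d (p - b) \<in> Jideal n k"
      unfolding I by (rule idl_hcomp[OF _ gens_pvars b(2)]) (rule gens_hom)
    moreover have "hcomp d (p - b) = p - hcomp d b"
      using p hcomp_of_hom[of p d d] by (simp add: H hcomp_diff)
    ultimately have "p - hcomp d b \<in> J"
      using p keys_stdexp_pvars[OF b(1)] by (auto simp: J_def H intro!: hom_of_deg_diff)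
    then have "p - hcomp d b \<in> span (C \<union> mon ` M)"
      using C(3) span_mono[of C "C \<union> mon ` M"] by blast
    moreover have "hcomp d b \<in> span (C \<union> mon ` M)"
    proof -
      have "keys (hcomp d b) \<subseteq> M"
        using b(1) by (auto simp: keys_hcomp M_def mdeg_expmon)
      then show ?thesis
        using span_mon[of "hcomp d b" M] span_mono[of "mon ` M" "C \<union> mon ` M"] by blast
    qed
    ultimately show "p \<in> span (C \<union> mon ` M)"
      using span_add by fastforce
  qed
  moreover have "C \<union> mon ` M \<subseteq> H"
    using C(1) monM by (auto simp: J_def)
  ultimately have "dim H = card (C \<union> mon ` M)"
    by (intro dim_unique) auto
  also have "\<dots> = dim J + card (mon ` M)"
    using \<open>finite C\<close> finM disj C(4) by (simp add: card_Un_disjoint)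
  finally show ?thesis
    by (simp add: hilbS_def cardM flip: H_def J_def)
qed

section \<open>Degrees of the standard monomials\<close>

definition stdgf :: "nat \<Rightarrow> nat \<Rightarrow> nat \<Rightarrow> nat poly" where
  "stdgf k N s = (\<Sum>e\<in>stdexp k N s. monom 1 (sum_list e))"

lemma coeff_stdgf: "coeff (stdgf k N s) d = card {e \<in> stdexp k N s. sum_list e = d}"
proof -
  have "coeff (stdgf k N s) d = (\<Sum>e\<in>stdexp k N s. if sum_list e = d then 1 else 0)"
    by (simp only: stdgf_def coeff_sum coeff_monom)
  also have "\<dots> = card {e \<in> stdexp k N s. sum_list e = d}"
    by (subst sum.inter_filter[symmetric]) auto
  finally show ?thesis .
qed

lemma sum_monom_Cons:
  "(\<Sum>l\<in>{c # e | c e. c \<in> X \<and> e \<in> E}. monom 1 (sum_list l))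
     = (\<Sum>c\<in>X. monom 1 c) * (\<Sum>e\<in>E. monom (1::nat) (sum_list e))"
proof -
  have "{c # e | c e. c \<in> X \<and> e \<in> E} = (\<lambda>(c, e). c # e) ` (X \<times> E)"
    by auto
  then have "(\<Sum>l\<in>{c # e | c e. c \<in> X \<and> e \<in> E}. monom (1::nat) (sum_list l))
      = (\<Sum>(c, e)\<in>X \<times> E. monom 1 (c + sum_list e))"
    by (simp add: sum.reindex inj_on_def case_prod_unfold)
  also have "\<dots> = (\<Sum>(c, e)\<in>X \<times> E. monom 1 c * monom 1 (sum_list e))"
    by (simp add: mult_monom)
  also have "\<dots> = (\<Sum>c\<in>X. monom 1 c) * (\<Sum>e\<in>E. monom 1 (sum_list e))"
    by (simp add: sum_product sum.cartesian_product)
  finally show ?thesis .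
qed

lemma sum_monom_interval: "s \<le> k \<Longrightarrow> (\<Sum>c\<in>{s..<k}. monom 1 c) = monom 1 s * qint (k - s)"
proof -
  assume "s \<le> k"
  then have "(\<Sum>c\<in>{s..<k}. monom (1::nat) c) = (\<Sum>c\<in>{0..<k - s}. monom 1 (c + s))"
    using sum.shift_bounds_nat_ivl[of "monom (1::nat)" 0 s "k - s"] by simp
  also have "\<dots> = monom 1 s * qint (k - s)"
    by (simp add: qint_def sum_distrib_left mult_monom atLeast0LessThan add.commute)
  finally show ?thesis .
qed

lemma stdgf_Suc:
  assumes "s \<le> k"
  shows "stdgf k (Suc N) s = qint s * stdgf k N (s - 1) + monom 1 s * qint (k - s) * stdgf k N s"
proof -
  have fin: "finite {c # e | c e. c \<in> X \<and> e \<in> E}" if "finite X" "finite E" for X :: "nat set" and E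
  proof -
    have "{c # e | c e. c \<in> X \<and> e \<in> E} = (\<lambda>(c, e). c # e) ` (X \<times> E)"
      by auto
    then show ?thesis
      using that by simp
  qed
  have split: "stdexp k (Suc N) s = {c # e | c e. c \<in> {..<s} \<and> e \<in> stdexp k N (s - 1)}
      \<union> {c # e | c e. c \<in> {s..<k} \<and> e \<in> stdexp k N s}"
    by auto
  have "stdgf k (Suc N) s = (\<Sum>l\<in>{c # e | c e. c \<in> {..<s} \<and> e \<in> stdexp k N (s - 1)}. monom 1 (sum_list l))
      + (\<Sum>l\<in>{c # e | c e. c \<in> {s..<k} \<and> e \<in> stdexp k N s}. monom 1 (sum_list l))"
    unfolding stdgf_def split by (intro sum.union_disjoint fin) auto
  then show ?thesis
    unfolding sum_monom_Cons sum_monom_interval[OF assms] by (simp add: stdgf_def qint_def)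
qed

lemma monom_one_0 [simp]: "monom (Suc 0) 0 = 1"
  by (simp add: monom_0 one_pCons)

lemma stdgf_0: "stdgf k 0 s = (if s = 0 then 1 else 0)"
  by (simp add: stdgf_def)

lemma stdexp_empty: "N < s \<Longrightarrow> stdexp k N s = {}"
  by (induction N arbitrary: s) auto

lemma stdgf_eq_0: "N < s \<Longrightarrow> stdgf k N s = 0"
  by (simp add: stdgf_def stdexp_empty)

lemma qint_Suc: "qint (Suc j) = qint j + monom 1 j"
  by (simp add: qint_def)

lemma qint_Suc': "qint (Suc j) = 1 + monom 1 1 * qint j"
  by (simp add: qint_def sum.lessThan_Suc_shift sum_distrib_left mult_monom monom_0 one_pCons
      del: sum.lessThan_Suc)

lemma qint_0 [simp]: "qint 0 = 0"
  by (simp add: qint_def)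

text \<open>On the level of words covering \<open>s\<close> of \<open>k\<close> letters: a further letter is used or it is not.\<close>

lemma stdgf_pascal: "s < k \<Longrightarrow> stdgf k N s = stdgf k N (Suc s) + monom 1 (N - s) * stdgf (k - 1) N s"
proof (induction N arbitrary: s)
  case 0
  show ?case
    by (simp add: stdgf_0 monom_0 one_pCons)
next
  case (Suc N)
  define j where "j = k - Suc s"
  have k: "k - s = Suc j" "k - Suc s = j" "k - 1 - s = j" "k - 1 = s + j"
    using Suc.prems by (auto simp: j_def)
  let ?q = "monom (1::nat)"
  let ?G = "stdgf k N" and ?G' = "stdgf (k - 1) N"
  have IH: "?G s = ?G (Suc s) + ?q (N - s) * ?G' s"
    by (rule Suc.IH[OF Suc.prems])
  \<comment> \<open>For s = 0 the truncated s - 1 is harmless: both sides carry the factor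
    \<open>qint 0\<close>.\<close>
  have A: "qint s * ?G (s - 1) = qint s * ?G s + ?q (Suc N - s) * (qint s * ?G' (s - 1))"
  proof (cases s)
    case (Suc s')
    have "?G s' = ?G s + ?q (N - s') * ?G' s'"
      using Suc.IH[of s'] Suc.prems Suc by simp
    then show ?thesis
      by (simp add: Suc algebra_simps)
  qed simp
  \<comment> \<open>For s > N the truncated exponents disagree, but then \<open>?G' s\<close> is
    zero.\<close>
  have B: "?q (Suc s) * ?q (N - s) * ?G' s = ?q (Suc N - s) * ?q s * ?G' s"
  proof (cases "s \<le> N")
    case True
    then show ?thesis
      by (simp add: mult_monom)
  qed (simp add: stdgf_eq_0)
  have "stdgf k (Suc N) s = qint s * ?G (s - 1) + ?q s * qint (Suc j) * ?G s"
    using stdgf_Suc[of s k N] Suc.prems by (simp add: k)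
  also have "\<dots> = qint (Suc s) * ?G s + ?q (Suc N - s) * (qint s * ?G' (s - 1))
      + ?q (Suc s) * qint j * ?G s"
  proof -
    \<comment> \<open>The split-off q^s completes [s] to [s+1], the coefficient needed in the
      recursion for s + 1.\<close>
    have "?q s * qint (Suc j) = ?q s + ?q (Suc s) * qint j"
      by (simp add: qint_Suc' distrib_left mult_monom flip: mult.assoc)
    then show ?thesis
      unfolding A qint_Suc[of s] by (simp only: algebra_simps)
  qed
  also have "?q (Suc s) * qint j * ?G s
      = ?q (Suc s) * qint j * ?G (Suc s) + qint j * (?q (Suc s) * ?q (N - s) * ?G' s)"
    by (subst IH) (simp add: algebra_simps)
  also have "qint j * (?q (Suc s) * ?q (N - s) * ?G' s) = ?q (Suc N - s) * (?q s * qint j * ?G' s)"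
    by (subst B) (simp add: algebra_simps)
  also have "qint (Suc s) * ?G s + ?q (Suc N - s) * (qint s * ?G' (s - 1))
      + (?q (Suc s) * qint j * ?G (Suc s) + ?q (Suc N - s) * (?q s * qint j * ?G' s))
      = (qint (Suc s) * ?G s + ?q (Suc s) * qint j * ?G (Suc s))
      + ?q (Suc N - s) * (qint s * ?G' (s - 1) + ?q s * qint j * ?G' s)"
    by (simp add: distrib_left add_ac)
  also have "qint (Suc s) * ?G s + ?q (Suc s) * qint j * ?G (Suc s) = stdgf k (Suc N) (Suc s)"
    using stdgf_Suc[of "Suc s" k N] Suc.prems by (simp add: k)
  also have "qint s * ?G' (s - 1) + ?q s * qint j * ?G' s = stdgf (k - 1) (Suc N) s"
    using stdgf_Suc[of s "k - 1" N] Suc.prems k(3) by simp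
  finally show ?case .
qed

text \<open>At s = k + 1 the second branch of \<open>stdgf_Suc\<close> is empty, which leaves the
  pair (k+1, k); the Pascal identity returns it to the diagonal. The result is the reversal of
  \<open>qfact_stirq_Suc\<close>.\<close>

lemma stdgf_diag_Suc:
  "stdgf (Suc k) (Suc n) (Suc k)
     = qint (Suc k) * (stdgf (Suc k) n (Suc k) + monom 1 (n - k) * stdgf k n k)"
  using stdgf_Suc[of "Suc k" "Suc k" n] stdgf_pascal[of k "Suc k" n] by simp

section \<open>Reversal of polynomials and comparison with the q-Stirling numbers\<close>

definition reverse_at :: "nat \<Rightarrow> nat poly \<Rightarrow> nat poly" where
  "reverse_at D p = (\<Sum>i\<le>D. monom (coeff p i) (D - i))"

lemma coeff_reverse_at: "coeff (reverse_at D p) i = (if i \<le> D then coeff p (D - i) else 0)"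
proof -
  have "coeff (reverse_at D p) i = (\<Sum>j\<le>D. if D - j = i then coeff p j else 0)"
    by (simp add: reverse_at_def coeff_sum)
  also have "\<dots> = (\<Sum>j\<le>D. if j = D - i \<and> i \<le> D then coeff p j else 0)"
    by (intro sum.cong) auto
  also have "\<dots> = (if i \<le> D then coeff p (D - i) else 0)"
    by (cases "i \<le> D") auto
  finally show ?thesis .
qed

text \<open>Additivity is the purpose of the fixed \<open>D\<close>: \<open>revq\<close> reverses at
  the actual degree, which may differ between summands.\<close>

lemma reverse_at_add: "reverse_at D (p + q) = reverse_at D p + reverse_at D q"
  by (rule poly_eqI) (simp add: coeff_reverse_at)

lemma reverse_at_0 [simp]: "reverse_at D 0 = 0"
  by (rule poly_eqI) (simp add: coeff_reverse_at)

lemma reverse_at_sum: "reverse_at D (sum f A) = (\<Sum>a\<in>A. reverse_at D (f a))"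
  by (induction A rule: infinite_finite_induct) (auto simp: reverse_at_add)

lemma reverse_at_monom_mult:
  assumes "degree p \<le> D" "i \<le> j"
  shows "reverse_at (j + D) (monom 1 i * p) = monom 1 (j - i) * reverse_at D p"
proof (rule poly_eqI)
  fix m
  have "coeff p (j + D - m - i) = 0" if "m < j - i"
    using that assms by (intro coeff_eq_0) simp
  moreover have "j + D - m - i = D - (m - (j - i))" if "\<not> m < j - i"
    using that assms by simp
  ultimately show "coeff (reverse_at (j + D) (monom 1 i * p)) m = coeff (monom 1 (j - i) * reverse_at D p) m"
    using assms by (auto simp: coeff_reverse_at coeff_monom_mult)
qed

lemma reverse_at_shift: "degree p \<le> D \<Longrightarrow> reverse_at (j + D) p = monom 1 j * reverse_at D p"
  using reverse_at_monom_mult[of p D 0 j] by simp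

text \<open>\<open>qint (Suc k)\<close> is palindromic of degree k, so it passes through the
  reversal.\<close>

lemma reverse_at_qint_mult:
  assumes "degree p \<le> D"
  shows "reverse_at (k + D) (qint (Suc k) * p) = qint (Suc k) * reverse_at D p"
proof -
  have "reverse_at (k + D) (qint (Suc k) * p) = (\<Sum>i<Suc k. reverse_at (k + D) (monom 1 i * p))"
    by (simp only: qint_def sum_distrib_right reverse_at_sum)
  also have "\<dots> = (\<Sum>i<Suc k. monom 1 (k - i) * reverse_at D p)"
    by (intro sum.cong refl reverse_at_monom_mult assms) auto
  also have "\<dots> = (\<Sum>i<Suc k. monom 1 (Suc k - Suc i)) * reverse_at D p"
    by (simp only: sum_distrib_right diff_Suc_Suc)
  also have "(\<Sum>i<Suc k. monom (1::nat) (Suc k - Suc i)) = qint (Suc k)"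
    unfolding qint_def by (rule sum.nat_diff_reindex)
  finally show ?thesis .
qed

lemma degree_qint_Suc: "degree (qint (Suc k)) \<le> k"
  unfolding qint_def by (intro degree_sum_le) (auto simp: degree_monom_eq)

text \<open>The degree of [k]!_q Stir_q(n,k) for 1 \<le> k \<le> n: k choose 2 from the factorial
  and (n-k)(k-1) from the Stirling part.\<close>

definition fubdeg :: "nat \<Rightarrow> nat \<Rightarrow> nat" where
  "fubdeg n k = (\<Sum>i<k. i) + (n - k) * (k - 1)"

lemma stirq_eq_0: "n < k \<Longrightarrow> stirq n k = 0"
  by (induction n k rule: stirq.induct) auto

lemma qfact_stirq_Suc:
  "qfact (Suc k) * stirq (Suc n) (Suc k)
     = qint (Suc k) * (qfact k * stirq n k + qfact (Suc k) * stirq n (Suc k))"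
  by (simp add: qfact_def algebra_simps)

lemma fubdeg_Suc_Suc: "k < n \<Longrightarrow> fubdeg (Suc n) (Suc k) = k + fubdeg n (Suc k)"
  by (simp add: fubdeg_def Suc_diff_Suc[symmetric])

lemma fubdeg_Suc: "1 \<le> k \<Longrightarrow> k < n \<Longrightarrow> fubdeg n (Suc k) = (n - k) + fubdeg n k"
  by (cases k) (simp_all add: fubdeg_def Suc_diff_Suc[symmetric])

text \<open>The degree bound is carried along because moving \<open>qint\<close> through the
  reversal requires it. The factor q^(n-j) of \<open>stdgf_diag_Suc\<close> arises as the gap
  between the degrees at which the two summands of the recursion are reversed.\<close>

lemma reverse_qfact_stirq:
  "degree (qfact k * stirq n k) \<le> fubdeg n k \<and>
   reverse_at (fubdeg n k) (qfact k * stirq n k) = stdgf k n k"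
proof (induction n arbitrary: k)
  case 0
  show ?case
  proof (cases k)
    case 0
    have "reverse_at 0 1 = 1"
      by (rule poly_eqI) (auto simp: coeff_reverse_at)
    then show ?thesis
      using 0 by (simp add: qfact_def stdgf_0 fubdeg_def)
  qed (simp add: stdgf_0)
next
  case (Suc n)
  show ?case
  proof (cases k)
    case 0
    then show ?thesis
      using stdgf_Suc[of 0 0 n] by simp
  next
    case (Suc j)
    define P where "P k = qfact k * stirq n k" for k
    have IH: "degree (P k) \<le> fubdeg n k" "reverse_at (fubdeg n k) (P k) = stdgf k n k" for k
      using Suc.IH[of k] by (simp_all add: P_def)
    have eq: "qfact k * stirq (Suc n) k = qint (Suc j) * (P j + P (Suc j))"
      unfolding Suc P_def by (rule qfact_stirq_Suc)
    have main: ?thesis if D: "fubdeg (Suc n) k = j + D" and deg: "degree (P j + P (Suc j)) \<le> D"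
      and rev: "reverse_at D (P j + P (Suc j)) = stdgf (Suc j) n (Suc j) + monom 1 (n - j) * stdgf j n j" for D
    proof -
      have "degree (qfact k * stirq (Suc n) k) \<le> j + D"
        unfolding eq using degree_mult_le[of "qint (Suc j)" "P j + P (Suc j)"] degree_qint_Suc[of j] deg
        by linarith
      moreover have "reverse_at (j + D) (qfact k * stirq (Suc n) k) = stdgf k (Suc n) k"
        unfolding eq reverse_at_qint_mult[OF deg] rev by (simp add: Suc stdgf_diag_Suc)
      ultimately show ?thesis
        by (simp add: D)
    qed
    consider "j < n" | "j = n" | "n < j"
      by linarith
    then show ?thesis
    proof cases
      case 1
      have shift: "degree (P j) \<le> fubdeg n (Suc j) \<and>
          reverse_at (fubdeg n (Suc j)) (P j) = monom 1 (n - j) * stdgf j n j"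
      \<comment> \<open>\<open>fubdeg_Suc\<close> fails at j = 0, but there both polynomials are
        zero because n > 0.\<close>
      proof (cases "j = 0")
        case True
        with 1 obtain n' where "n = Suc n'"
          by (cases n) auto
        then show ?thesis
          using True stdgf_Suc[of 0 0 n'] by (simp add: P_def)
      next
        case False
        then have "fubdeg n (Suc j) = (n - j) + fubdeg n j"
          using 1 by (intro fubdeg_Suc) auto
        then show ?thesis
          using IH[of j] reverse_at_shift[of "P j" "fubdeg n j" "n - j"] by simp
      qed
      show ?thesis
        by (rule main[of "fubdeg n (Suc j)"])
           (use 1 shift IH[of "Suc j"] in \<open>auto simp: Suc fubdeg_Suc_Suc reverse_at_add degree_add_le add.commute\<close>)
    next
      case 2
      have "P (Suc j) = 0" "stdgf (Suc j) n (Suc j) = 0"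
        using 2 by (auto simp: P_def stirq_eq_0 stdgf_eq_0)
      moreover have "fubdeg (Suc n) k = j + fubdeg n j"
        using 2 by (simp add: Suc fubdeg_def)
      ultimately show ?thesis
        using IH[of j] 2 by (intro main[of "fubdeg n j"]) auto
    next
      case 3
      then show ?thesis
        by (simp add: Suc stirq_eq_0 stdgf_eq_0 del: stirq.simps)
    qed
  qed
qed

lemma replicate_0_stdexp: "1 \<le> k \<Longrightarrow> s \<le> n \<Longrightarrow> replicate n 0 \<in> stdexp k n s"
  by (induction n arbitrary: s) (auto simp: le_Suc_eq)

text \<open>The zero exponent vector is standard, so the reversed polynomial has nonzero constant
  term. Hence the bound \<open>fubdeg n k\<close> is the exact degree and \<open>reverse_at\<close>
  coincides with \<open>revq\<close>.\<close>

lemma revq_qfact_stirq: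
  assumes "1 \<le> k" "k \<le> n"
  shows "revq (qfact k * stirq n k) = stdgf k n k"
proof -
  let ?P = "qfact k * stirq n k"
  have "replicate n 0 \<in> {e \<in> stdexp k n k. sum_list e = 0}"
    using replicate_0_stdexp[OF assms] by simp
  then have "card {e \<in> stdexp k n k. sum_list e = 0} \<noteq> 0"
    by (subst card_0_eq) auto
  then have "coeff (stdgf k n k) 0 \<noteq> 0"
    by (simp add: coeff_stdgf)
  then have "coeff (reverse_at (fubdeg n k) ?P) 0 \<noteq> 0"
    using reverse_qfact_stirq[of k n] by simp
  then have "coeff ?P (fubdeg n k) \<noteq> 0"
    by (simp add: coeff_reverse_at)
  then have "degree ?P = fubdeg n k"
    using reverse_qfact_stirq[of k n] le_degree by (intro antisym) auto
  then show ?thesis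
    using reverse_qfact_stirq[of k n] by (simp add: revq_def reverse_at_def)
qed

theorem mainTheorem7:
  fixes n k d :: nat
  assumes "1 \<le> k" and "k \<le> n"
  shows "hilbS TYPE('a::field) n k d = coeff (revq (qfact k * stirq n k)) d"
  using assms by (simp add: hilbS_eq_card revq_qfact_stirq coeff_stdgf)

end
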